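(* Let $k$ be an integer with $2\le k<1000$, and let \[P_k(z)=\frac{(2\pi)^{2k-1}}{(2k)!}\sum_{j=0}^{k}(-1)^j B_{2j}B_{2k-2j}\binom{2k}{2j}z^{2j}+\zeta(2k-1)\left(z^{2k-1}+(-1)^k z\right).\] Then all of the zeros of $P_k(z)$ lie on the unit circle $|z|=1$, and all of the zeros are simple.
   Context: $B_n$ denotes the $n$th Bernoulli number, defined by $\dfrac{t}{e^t-1}=\sum_{n\ge0}B_n\dfrac{t^n}{n!}$, and $\zeta$ is the Riemann zeta function. *)

theory Defs
  imports
    "HOL-Analysis.Analysis"
    "HOL-Computational_Algebra.Computational_Algebra"
begin

text \<open>
  The quotient is exact division of formal power series: the denominator has subdegree 1,
  as does the numerator.  The resulting convention is \<open>bernoulli 1 = -1/2\<close>.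
\<close>

definition bernoulli :: "nat \<Rightarrow> real" where
  "bernoulli n = fact n * fps_nth (fps_X / (fps_exp 1 - 1)) n"

lemma bernoulli_fps:
  "Abs_fps (\<lambda>n. bernoulli n / fact n) * (fps_exp 1 - 1) = fps_X"
proof -
  have sub: "subdegree (fps_exp 1 - 1 :: real fps) = 1"
    by (rule subdegreeI) auto
  have nz: "fps_exp 1 - 1 \<noteq> (0 :: real fps)"
    using sub by auto
  have eq: "Abs_fps (\<lambda>n. bernoulli n / fact n) = fps_X / (fps_exp 1 - 1)"
    by (rule fps_ext) (simp add: bernoulli_def)
  have "(fps_exp 1 - 1 :: real fps) dvd fps_X"
    using fps_dvd_iff[OF nz, of fps_X] sub by simp
  thus ?thesis
    unfolding eq by simp
qed

text \<open>
  The Dirichlet series of the Riemann zeta function, which defines it for \<open>Re s > 1\<close>.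
  The analytic continuation is not needed: only the values at the integers
  \<open>2 * k - 1 \<ge> 3\<close> occur below.
\<close>

definition zeta :: "complex \<Rightarrow> complex" where
  "zeta s = (\<Sum>n. 1 / of_nat (Suc n) powr s)"

definition P_poly :: "nat \<Rightarrow> complex poly" where
  "P_poly k =
     smult (of_real ((2 * pi) ^ (2 * k - 1) / fact (2 * k)))
       (\<Sum>j=0..k. monom ((-1) ^ j * of_real (bernoulli (2 * j)) * of_real (bernoulli (2 * k - 2 * j))
                         * of_nat ((2 * k) choose (2 * j))) (2 * j))
     + smult (zeta (of_nat (2 * k - 1))) (monom 1 (2 * k - 1) + monom ((-1) ^ k) 1)"

lemma poly_P_poly:
  "poly (P_poly k) z =
     (2 * of_real pi) ^ (2 * k - 1) / fact (2 * k)
       * (\<Sum>j=0..k. (-1) ^ j * of_real (bernoulli (2 * j)) * of_real (bernoulli (2 * k - 2 * j))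
                      * of_nat ((2 * k) choose (2 * j)) * z ^ (2 * j))
     + zeta (of_nat (2 * k - 1)) * (z ^ (2 * k - 1) + (-1) ^ k * z)"
  by (simp add: P_poly_def poly_sum poly_monom)

end

theory Submission
  imports Defs
begin

text \<open>
  Put \<open>z = \<i> w\<close>. Euler's formula for \<open>\<zeta>(2j)\<close> turns \<open>P\<^sub>k(\<i> w)\<close> into \<open>(-1)\<^sup>k\<close> times
  \<open>(2/\<pi>) \<Sum>\<^sub>j \<zeta>(2j) \<zeta>(2k-2j) w\<^bsup>2j\<^esup> + \<i> \<zeta>(2k-1) (w - w\<^bsup>2k-1\<^esup>)\<close>, with \<open>\<zeta>(0) = -1/2\<close>.
  Writing the products of zeta values as double series over \<open>m, n\<close>, summing the geometric
  progression in \<open>j\<close> and using the partial fractions of the cotangent gives Ramanujan's formula: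
  on \<open>\<bar>w\<bar> = 1\<close>, \<open>w \<noteq> \<plusminus>1\<close>, this equals \<open>4 w\<^sup>k Im (w\<^bsup>1-k\<^esup> L(w))\<close> where
  \<open>L(w) = \<Sum>\<^sub>m m\<^bsup>1-2k\<^esup> / (exp (2\<pi>\<i>mw) - 1)\<close>.

  On the upper half circle \<open>Re L < 0\<close>, so the sign alternates at the points where the phase
  \<open>(k-1)\<theta>\<close> is an odd multiple of \<open>\<pi>/2\<close>; this gives \<open>k - 2\<close> zeros. On the lower half circle,
  \<open>w = exp(-\<i>t)\<close>, the real part of \<open>exp (2\<pi>\<i>w) L\<close> is positive, because its term \<open>m = 1\<close> dominates
  the others; the sign alternates at the points where the phase \<open>(k-1)t + 2\<pi>(1 - cos t)\<close>, which increases
  from \<open>0\<close> to \<open>(k+3)\<pi>\<close>, is an odd multiple of \<open>\<pi>/2\<close>; this gives \<open>k + 2\<close> zeros. These \<open>2k\<close> zeros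
  exhaust the degree.
\<close>

section \<open>Partial fractions of the cotangent\<close>

text \<open>Logarithmic derivative of Euler's reflection formula: Gamma(z) Gamma(1 - z) is
  differentiated both as a product and as pi / sin(pi z).\<close>

lemma Digamma_reflection_complex:
  fixes z :: complex
  assumes "z \<notin> \<int>"
  shows "Digamma (1 - z) - Digamma z = of_real pi * cot (of_real pi * z)"
proof -
  have nz: "z \<notin> \<int>\<^sub>\<le>\<^sub>0" "1 - z \<notin> \<int>\<^sub>\<le>\<^sub>0"
    using assms nonpos_Ints_Int Ints_diff[of 1 "1 - z"] Ints_1 by auto
  have s: "sin (of_real pi * z) \<noteq> 0"
    using assms by (auto simp: sin_eq_0)
  let ?g = "\<lambda>z::complex. Gamma z * Gamma (1 - z)"
  have "(?g has_field_derivative (?g z * (Digamma z - Digamma (1 - z)))) (at z)"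
    using nz by (auto intro!: derivative_eq_intros simp: algebra_simps)
  moreover have "?g = (\<lambda>z. of_real pi / sin (of_real pi * z))"
    using Gamma_reflection_complex by blast
  moreover have "((\<lambda>z. of_real pi / sin (of_real pi * z)) has_field_derivative
      - (of_real pi)\<^sup>2 * cos (of_real pi * z) / (sin (of_real pi * z))\<^sup>2) (at z)"
    using s by (auto intro!: derivative_eq_intros simp: power2_eq_square)
  ultimately have "of_real pi / sin (of_real pi * z) * (Digamma z - Digamma (1 - z))
      = - (of_real pi)\<^sup>2 * cos (of_real pi * z) / (sin (of_real pi * z))\<^sup>2"
    using DERIV_unique by metis
  hence "(Digamma (1 - z) - Digamma z) * (of_real pi / sin (of_real pi * z))
      = (of_real pi * cot (of_real pi * z)) * (of_real pi / sin (of_real pi * z))"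
    using s by (simp add: cot_def algebra_simps power2_eq_square)
  moreover have "of_real pi / sin (of_real pi * z) \<noteq> 0"
    using s by simp
  ultimately show ?thesis
    by (metis mult_right_cancel)
qed

text \<open>In the limit formulas for \<open>Digamma\<close> at 1 - z and 1 + z the logarithms
  cancel, leaving a series of differences; the recurrence at z and the reflection formula evaluate
  it as a cotangent.\<close>

lemma cot_partial_fractions:
  fixes z :: complex
  assumes z: "z \<notin> \<int>"
  shows "(\<lambda>n. 1 / ((of_nat (Suc n))\<^sup>2 - z\<^sup>2)) sums ((1 / z - of_real pi * cot (of_real pi * z)) / (2 * z))"
proof -
  have z0: "z \<noteq> 0" using z by auto
  have nz: "1 + z \<noteq> 0" "1 - z \<noteq> 0"
    using z Ints_minus[of 1] Ints_1 by (metis add_eq_0_iff minus_minus Ints_minus, metis Ints_1 eq_iff_diff_eq_0)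
  have nz': "of_nat (Suc n) + z \<noteq> 0" "of_nat (Suc n) - z \<noteq> 0" for n
    using z by (metis Ints_minus Ints_of_nat add_eq_0_iff2 minus_minus, metis Ints_of_nat eq_iff_diff_eq_0)
  have "(\<lambda>m. \<Sum>n<m. inverse (1 + z + of_nat n) - inverse (1 - z + of_nat n))
      \<longlonglongrightarrow> Digamma (1 - z) - Digamma (1 + z)"
    using tendsto_diff[OF Digamma_LIMSEQ[OF nz(2)] Digamma_LIMSEQ[OF nz(1)]]
    by (simp add: sum_subtractf)
  hence "(\<lambda>n. inverse (1 + z + of_nat n) - inverse (1 - z + of_nat n)) sums
      (of_real pi * cot (of_real pi * z) - 1 / z)"
    using Digamma_plus1[OF z0] Digamma_reflection_complex[OF z]
    by (simp add: sums_def algebra_simps)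
  hence "(\<lambda>n. (inverse (1 + z + of_nat n) - inverse (1 - z + of_nat n)) * (- 1 / (2 * z))) sums
      ((of_real pi * cot (of_real pi * z) - 1 / z) * (- 1 / (2 * z)))"
    by (rule sums_mult2)
  moreover have "(inverse (1 + z + of_nat n) - inverse (1 - z + of_nat n)) * (- 1 / (2 * z))
      = 1 / ((of_nat (Suc n))\<^sup>2 - z\<^sup>2)" for n
  proof -
    have e: "(of_nat (Suc n))\<^sup>2 - z\<^sup>2 = (of_nat (Suc n) + z) * (of_nat (Suc n) - z)"
      by (simp add: power2_eq_square algebra_simps)
    have "inverse (1 + z + of_nat n) - inverse (1 - z + of_nat n)
        = inverse (of_nat (Suc n) + z) - inverse (of_nat (Suc n) - z)"
      by (simp add: algebra_simps)
    also have "\<dots> = - (2 * z) / ((of_nat (Suc n) + z) * (of_nat (Suc n) - z))"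
      using nz'[of n] by (simp add: field_simps del: of_nat_Suc)
    finally show ?thesis
      using z0 by (simp add: e del: of_nat_Suc)
  qed
  moreover have "(of_real pi * cot (of_real pi * z) - 1 / z) * (- 1 / (2 * z))
      = (1 / z - of_real pi * cot (of_real pi * z)) / (2 * z)"
    using z0 by (simp add: field_simps)
  ultimately show ?thesis by simp
qed

text \<open>The quantity 1 / (exp(2 pi i z) - 1) links the cotangent both to the generating function
  of the Bernoulli numbers and to the terms of the Lambert series.\<close>

lemma cot_pi_conv_exp:
  fixes z :: complex
  assumes "z \<notin> \<int>"
  shows "cot (of_real pi * z) = \<i> + 2 * \<i> / (exp (2 * of_real pi * \<i> * z) - 1)"
    and "exp (2 * of_real pi * \<i> * z) \<noteq> 1"
proof -
  define e where "e = exp (\<i> * (of_real pi * z))"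
  have e0: "e \<noteq> 0" by (simp add: e_def)
  have ei: "exp (- (\<i> * (of_real pi * z))) = 1 / e" by (simp add: e_def exp_minus inverse_eq_divide)
  have e2: "exp (2 * of_real pi * \<i> * z) = e\<^sup>2"
    by (simp add: e_def mult_ac flip: exp_of_nat_mult)
  have s: "sin (of_real pi * z) = (e - 1 / e) / (2 * \<i>)"
    unfolding sin_exp_eq e_def [symmetric] ei ..
  have c: "cos (of_real pi * z) = (e + 1 / e) / 2"
    unfolding cos_exp_eq e_def [symmetric] ei ..
  have "sin (of_real pi * z) \<noteq> 0"
    using assms by (auto simp: sin_eq_0)
  hence e1: "e\<^sup>2 \<noteq> 1"
    using e0 unfolding s by (auto simp: field_simps power2_eq_square)
  thus "exp (2 * of_real pi * \<i> * z) \<noteq> 1" by (simp add: e2)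
  have "e - 1 / e \<noteq> 0" "e\<^sup>2 - 1 \<noteq> 0"
    using e0 e1 by (auto simp: field_simps power2_eq_square)
  then show "cot (of_real pi * z) = \<i> + 2 * \<i> / (exp (2 * of_real pi * \<i> * z) - 1)"
    unfolding cot_def s c e2 using e0 by (simp add: field_simps power2_eq_square) 
qed

text \<open>Supplies product majorants for the double series whose order of summation is exchanged
  below.\<close>

lemma summable_on_mult_Times:
  fixes f :: "'a \<Rightarrow> real" and g :: "'b \<Rightarrow> real"
  assumes "f summable_on UNIV" "g summable_on UNIV" "\<And>n. f n \<ge> 0" "\<And>n. g n \<ge> 0"
  shows "(\<lambda>(m, n). f m * g n) summable_on UNIV \<times> UNIV"
proof (rule Infinite_Sum.abs_summable_summable, rule iffD2[OF Infinite_Sum.abs_summable_on_Sigma_iff])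
  have "\<bar>infsum g UNIV\<bar> = infsum g UNIV"
    using assms by (simp add: infsum_nonneg)
  then show "(\<forall>x\<in>UNIV. (\<lambda>y. norm (case (x, y) of (m, n) \<Rightarrow> f m * g n)) summable_on UNIV) \<and>
      (\<lambda>x. norm (\<Sum>\<^sub>\<infinity>y. norm (case (x, y) of (m, n) \<Rightarrow> f m * g n))) summable_on UNIV"
    using assms
    by (auto simp: infsum_cmult_right' abs_mult intro!: summable_on_cmult_right summable_on_cmult_left)
qed

section \<open>Zeta values at even integers\<close>

text \<open>Real-valued and with ordinary powers: conjugation fixes the values, and series can be
  compared over the reals.\<close>

definition zeta_nat :: "nat \<Rightarrow> real" where
  "zeta_nat n = (\<Sum>m. 1 / real (Suc m) ^ n)"

lemma zeta_nat_sums: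
  assumes "n \<ge> 2"
  shows "(\<lambda>m. 1 / real (Suc m) ^ n) sums zeta_nat n"
proof -
  have "summable (\<lambda>m. inverse (real m ^ n))"
    using inverse_power_summable[of n, where 'a = real] assms by simp
  hence "summable (\<lambda>m. inverse (real (Suc m) ^ n))"
    by (subst summable_Suc_iff)
  thus ?thesis
    unfolding zeta_nat_def by (simp add: summable_sums inverse_eq_divide)
qed

lemma zeta_nat_has_sum:
  assumes "n \<ge> 2"
  shows "((\<lambda>m. 1 / real (Suc m) ^ n) has_sum zeta_nat n) UNIV"
  by (intro sums_nonneg_imp_has_sum zeta_nat_sums assms) auto

lemma zeta_nat_has_sum_complex:
  assumes "n \<ge> 2"
  shows "((\<lambda>m. 1 / of_nat (Suc m) ^ n :: complex) has_sum of_real (zeta_nat n)) UNIV"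
  using has_sum_of_real[OF zeta_nat_has_sum[OF assms], where 'a = complex]
  by (simp del: of_nat_Suc)

lemma zeta_of_nat:
  assumes "n \<ge> 2"
  shows "zeta (of_nat n) = of_real (zeta_nat n)"
proof -
  have "(\<lambda>m. 1 / of_nat (Suc m) powr of_nat n :: complex) sums of_real (zeta_nat n)"
    using has_sum_imp_sums[OF zeta_nat_has_sum_complex[OF assms]]
    by (subst powr_nat') (simp_all del: of_nat_Suc)
  thus ?thesis
    unfolding zeta_def using sums_unique by metis
qed

lemma zeta_nat_gt_1:
  assumes "n \<ge> 2"
  shows "zeta_nat n > 1"
proof -
  have "(\<Sum>m<2. 1 / real (Suc m) ^ n) \<le> zeta_nat n"
    unfolding zeta_nat_def
    by (rule sum_le_suminf) (use zeta_nat_sums[OF assms] in \<open>auto simp: sums_iff\<close>)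
  moreover have "(\<Sum>m<2. 1 / real (Suc m) ^ n) > 1"
    by (simp add: numeral_2_eq_2)
  ultimately show ?thesis by linarith
qed

text \<open>The double series of (z / (n + 1)) ^ (2j + 2) is summed in both orders: over j it is
  geometric and yields the partial fractions, over n it yields zeta values.\<close>

lemma cot_power_series:
  fixes z :: complex
  assumes z: "z \<notin> \<int>" and z1: "norm z < 1"
  shows "(\<lambda>j. of_real (zeta_nat (2 * j + 2)) * z ^ (2 * j + 2)) sums
    ((1 - of_real pi * z * cot (of_real pi * z)) / 2)"
proof -
  define f :: "nat \<times> nat \<Rightarrow> complex" where "f = (\<lambda>(n, j). (z / of_nat (Suc n)) ^ (2 * j + 2))"
  define r where "r = norm z"
  have r: "0 \<le> r" "r < 1" using z1 by (auto simp: r_def)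
  have r2: "r\<^sup>2 < 1" using r by (simp add: power_less_one_iff abs_square_less_1)
  have z0: "z \<noteq> 0" using z by auto
  have geo: "(\<lambda>j. r ^ (2 * j)) sums (1 / (1 - r\<^sup>2))"
    unfolding power_mult using geometric_sums[of "r\<^sup>2"] r2 by simp
  \<comment> \<open>As r < 1 and n + 1 >= 1, lowering the exponent of r to 2j and that of 1 / (n +
    1) to 2 only enlarges the terms, and it separates the variables.\<close>
  have maj: "(\<lambda>(n, j). (1 / real (Suc n) ^ 2) * r ^ (2 * j)) summable_on UNIV \<times> UNIV"
    using has_sum_imp_summable[OF zeta_nat_has_sum[of 2]] has_sum_imp_summable[OF sums_nonneg_imp_has_sum[OF geo]] r
    by (intro summable_on_mult_Times) auto
  have summ: "f summable_on UNIV \<times> UNIV"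
  proof (rule Infinite_Sum.abs_summable_summable, rule Infinite_Sum.abs_summable_on_comparison_test'[OF maj])
    fix x :: "nat \<times> nat"
    obtain n j where x: "x = (n, j)" by force
    have "norm (f x) = r ^ (2 * j + 2) * (1 / real (Suc n) ^ (2 * j + 2))"
      by (simp add: x f_def r_def norm_power norm_divide norm_mult power_divide del: of_nat_Suc)
    also have "\<dots> \<le> r ^ (2 * j) * (1 / real (Suc n) ^ 2)"
      using r by (intro mult_mono power_decreasing divide_left_mono power_increasing) auto
    finally show "norm (f x) \<le> (case x of (n, j) \<Rightarrow> 1 / (real (Suc n))\<^sup>2 * r ^ (2 * j))"
      by (simp add: x mult_ac)
  qed
  then obtain S where S: "(f has_sum S) (UNIV \<times> UNIV)"
    by (auto simp: summable_on_def)
  have row: "((\<lambda>j. f (n, j)) has_sum z\<^sup>2 * (1 / ((of_nat (Suc n))\<^sup>2 - z\<^sup>2))) UNIV" for n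
  proof -
    define q where "q = (z / of_nat (Suc n))\<^sup>2"
    have "norm q = r\<^sup>2 / (real (Suc n))\<^sup>2"
      by (simp add: q_def r_def norm_power norm_divide power_divide del: of_nat_Suc)
    also have "\<dots> \<le> r\<^sup>2 / 1"
      by (intro divide_left_mono) auto
    finally have q: "norm q < 1" using r2 by simp
    have "(\<lambda>j. q * q ^ j) sums (q * (1 / (1 - q)))"
      by (intro sums_mult geometric_sums q)
    moreover have "summable (\<lambda>j. norm (q * q ^ j))"
      unfolding norm_mult norm_power using q by (intro summable_mult summable_geometric) simp
    ultimately have "((\<lambda>j. q * q ^ j) has_sum (q * (1 / (1 - q)))) UNIV"
      by (intro norm_summable_imp_has_sum)
    moreover have "q * q ^ j = f (n, j)" for j
    proof -
      have "q * q ^ j = (z / of_nat (Suc n)) ^ (2 * Suc j)"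
        unfolding q_def power_mult by (rule power_Suc [symmetric])
      thus ?thesis by (simp add: f_def)
    qed
    moreover have "q * (1 / (1 - q)) = z\<^sup>2 * (1 / ((of_nat (Suc n))\<^sup>2 - z\<^sup>2))"
    proof -
      have "(of_nat (Suc n))\<^sup>2 \<noteq> (0::complex)" by (simp del: of_nat_Suc)
      thus ?thesis
        by (simp add: q_def power_divide divide_simps del: of_nat_Suc)
    qed
    ultimately show ?thesis by simp
  qed
  have col: "((\<lambda>n. f (n, j)) has_sum of_real (zeta_nat (2 * j + 2)) * z ^ (2 * j + 2)) UNIV" for j
    using has_sum_cmult_right[OF zeta_nat_has_sum_complex[of "2 * j + 2"], of "z ^ (2 * j + 2)"]
    by (simp add: f_def power_divide mult.commute del: of_nat_Suc power_Suc power_Suc2)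
  have "((\<lambda>n. z\<^sup>2 * (1 / ((of_nat (Suc n))\<^sup>2 - z\<^sup>2))) has_sum S) UNIV"
    by (rule has_sum_SigmaD[OF S row])
  hence "(\<lambda>n. z\<^sup>2 * (1 / ((of_nat (Suc n))\<^sup>2 - z\<^sup>2))) sums S"
    by (rule has_sum_imp_sums)
  moreover have "(\<lambda>n. z\<^sup>2 * (1 / ((of_nat (Suc n))\<^sup>2 - z\<^sup>2))) sums
      (z\<^sup>2 * ((1 / z - of_real pi * cot (of_real pi * z)) / (2 * z)))"
    by (intro sums_mult cot_partial_fractions z)
  ultimately have S_eq: "S = z\<^sup>2 * ((1 / z - of_real pi * cot (of_real pi * z)) / (2 * z))"
    using sums_unique2 by blast
  have "((\<lambda>j. of_real (zeta_nat (2 * j + 2)) * z ^ (2 * j + 2)) has_sum S) UNIV"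
  proof (rule has_sum_SigmaD)
    show "((\<lambda>(x,y). f (y,x)) has_sum S) (UNIV \<times> UNIV)"
      using S by (subst has_sum_swap [symmetric])
  qed (use col in simp)
  moreover have "S = (1 - of_real pi * z * cot (of_real pi * z)) / 2"
    unfolding S_eq using z0 by (simp add: field_simps power2_eq_square)
  ultimately show ?thesis
    by (metis has_sum_imp_sums)
qed

section \<open>Bernoulli numbers and Euler's formula\<close>

lemma bernoulli_fps_complex:
  "Abs_fps (\<lambda>n. of_real (bernoulli n / fact n)) * (fps_exp 1 - 1) = (fps_X :: complex fps)"
proof (rule fps_ext)
  fix n
  have "fps_nth (Abs_fps (\<lambda>n. of_real (bernoulli n / fact n)) * (fps_exp 1 - 1) :: complex fps) n
      = of_real (fps_nth (Abs_fps (\<lambda>n. bernoulli n / fact n) * (fps_exp 1 - 1)) n)"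
    by (auto simp: fps_mult_nth fps_one_nth intro!: sum.cong)
  also have "\<dots> = fps_nth (fps_X :: complex fps) n"
    by (simp add: bernoulli_fps)
  finally show "fps_nth (Abs_fps (\<lambda>n. of_real (bernoulli n / fact n)) * (fps_exp 1 - 1)) n
      = fps_nth (fps_X :: complex fps) n" .
qed

lemma not_Ints_if_norm_less_1:
  fixes z :: complex
  assumes "z \<noteq> 0" "norm z < 1"
  shows "z \<notin> \<int>"
proof
  assume "z \<in> \<int>"
  then obtain n where n: "z = of_int n" by (elim Ints_cases)
  hence "\<bar>real_of_int n\<bar> < 1" using assms(2) by simp
  hence "n = 0" by linarith
  thus False using assms(1) n by simp
qed

text \<open>With t = 2 pi i z one has t / (e^t - 1) = pi z cot(pi z) - t / 2, and
  \<open>cot_power_series\<close> expands the cotangent. Equality of functions near 0 then gives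
  equality of formal power series.\<close>

lemma bernoulli_expansion:
  defines "E \<equiv> Abs_fps (\<lambda>n. if even n \<and> n \<noteq> 0 then - 2 * of_real (zeta_nat n) / (2 * of_real pi * \<i>) ^ n else 0)"
  shows "Abs_fps (\<lambda>n. of_real (bernoulli n / fact n)) = 1 - fps_const (1 / 2) * fps_X + E"
proof -
  define A where "A = 1 - fps_const (1 / 2) * fps_X + E"
  have pos: "fps_nth E n = (if even n \<and> n \<noteq> 0 then - 2 * of_real (zeta_nat n) / (2 * of_real pi * \<i>) ^ n else 0)" for n
    by (simp add: E_def)
  have E_sums: "(\<lambda>n. fps_nth E n * t ^ n) sums (of_real pi * z * cot (of_real pi * z) - 1)"
    if t: "t \<noteq> 0" "norm t \<le> 1" "z = t / (2 * of_real pi * \<i>)" for t z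
  proof -
    have nz: "norm z = norm t / (2 * pi)"
      using t by (simp add: norm_divide norm_mult)
    also have "\<dots> < 1" using t pi_gt3 by (simp add: field_simps)
    finally have z1: "norm z < 1" .
    have z0: "z \<noteq> 0" using t by simp
    have zI: "z \<notin> \<int>"
      by (rule not_Ints_if_norm_less_1[OF z0 z1])
    have neg: "(\<lambda>j. - 2 * (of_real (zeta_nat (2 * j + 2)) * z ^ (2 * j + 2))) sums
        (- 2 * ((1 - of_real pi * z * cot (of_real pi * z)) / 2))"
      by (rule sums_mult[OF cot_power_series[OF zI z1]])
    have eq: "(\<lambda>j. - 2 * (of_real (zeta_nat (2 * j + 2)) * z ^ (2 * j + 2)))
        = (\<lambda>j. fps_nth E (2 * j + 2) * t ^ (2 * j + 2))"
    proof
      fix j :: nat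
      have "fps_nth E (2 * j + 2) = - 2 * of_real (zeta_nat (2 * j + 2)) / (2 * of_real pi * \<i>) ^ (2 * j + 2)"
        by (simp only: pos) simp
      thus "- 2 * (of_real (zeta_nat (2 * j + 2)) * z ^ (2 * j + 2)) = fps_nth E (2 * j + 2) * t ^ (2 * j + 2)"
        unfolding t(3) power_divide by (simp only: times_divide_eq_left times_divide_eq_right mult.assoc)
    qed
    have *: "(\<lambda>j. fps_nth E (2 * j + 2) * t ^ (2 * j + 2)) sums
      (of_real pi * z * cot (of_real pi * z) - 1)" 
      using neg unfolding eq by (simp add: diff_divide_distrib)
    \<comment> \<open>The coefficients of \<open>E\<close> vanish off the positive even indices, so
      the series over j is the series over all n.\<close>
    have mono: "strict_mono (\<lambda>j::nat. 2 * j + 2)"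
      by (auto simp: strict_mono_def)
    have "fps_nth E n * t ^ n = 0" if "n \<notin> range (\<lambda>j::nat. 2 * j + 2)" for n
    proof -
      have "\<not> (even n \<and> n \<noteq> 0)"
      proof
        assume "even n \<and> n \<noteq> 0"
        then obtain m where "n = 2 * m" "m \<noteq> 0" by (auto elim!: evenE)
        hence "n = (\<lambda>j. 2 * j + 2) (m - 1)" by simp
        thus False using that by (metis rangeI)
      qed
      thus ?thesis by (auto simp: pos)
    qed
    with * show ?thesis
      by (subst (asm) sums_mono_reindex[where f = "\<lambda>n. fps_nth E n * t ^ n", OF mono])
  qed
  \<comment> \<open>Convergence at the single point t = 1 already gives radius at least 1.\<close>
  have "conv_radius (fps_nth E) \<ge> norm (1 :: complex)"
    by (intro conv_radius_geI sums_summable[OF E_sums]) simp_all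
  hence radE: "fps_conv_radius E \<ge> 1"
    by (simp add: fps_conv_radius_def flip: one_ereal_def)
  have radX: "fps_conv_radius (fps_const (1 / 2) * fps_X :: complex fps) \<ge> 1"
    by (rule order.trans[OF _ fps_conv_radius_mult]) simp
  have radA': "fps_conv_radius (1 - fps_const (1 / 2) * fps_X :: complex fps) \<ge> 1"
    using radX by (intro order.trans[OF _ fps_conv_radius_diff] min.boundedI) simp_all
  have radA: "fps_conv_radius A \<ge> 1"
    unfolding A_def using radE radA' by (intro order.trans[OF _ fps_conv_radius_add]) simp
  have radexp: "fps_conv_radius (fps_exp 1 - 1 :: complex fps) \<ge> 1"
    by (rule order.trans[OF _ fps_conv_radius_diff]) simp
  have ltrad: "ereal (norm t) < fps_conv_radius F" if "fps_conv_radius F \<ge> 1" "norm t < 1" for t and F :: "complex fps"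
    using that by (intro less_le_trans[of _ 1 "fps_conv_radius F"]) simp_all
  \<comment> \<open>The functions are compared on the unit disc after multiplication by e^t - 1, so
    that t = 0 needs no division; the factor is cancelled formally at the end.\<close>
  have "A * (fps_exp 1 - 1) = fps_X"
  proof (rule eval_fps_eqD)
    show "0 < fps_conv_radius (A * (fps_exp 1 - 1))"
    proof (rule less_le_trans)
      show "1 \<le> fps_conv_radius (A * (fps_exp 1 - 1))"
        using radA radexp by (intro order.trans[OF _ fps_conv_radius_mult] min.boundedI)
    qed simp
    have "eval_fps (A * (fps_exp 1 - 1)) t = eval_fps fps_X t" if t: "t \<in> ball 0 1" for t
    proof -
      have t1: "norm t < 1" using t by simp
      define z where "z = t / (2 * of_real pi * \<i>)"
      have "eval_fps (A * (fps_exp 1 - 1)) t = eval_fps A t * (exp t - 1)"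
        using ltrad[OF radA t1] ltrad[OF radexp t1]
        by (simp add: eval_fps_mult eval_fps_diff)
      also have "eval_fps A t = 1 - t / 2 + eval_fps E t"
        unfolding A_def using ltrad[OF radX t1] ltrad[OF radA' t1] ltrad[OF radE t1]
        by (simp add: eval_fps_add eval_fps_diff eval_fps_mult)
      also have "\<dots> * (exp t - 1) = t"
      proof (cases "t = 0")
        case False
        have t2: "2 * of_real pi * \<i> * z = t" by (simp add: z_def)
        have "norm z = norm t / (2 * pi)"
          by (simp add: z_def norm_divide norm_mult)
        also have "\<dots> < 1" using t1 pi_gt3 by (simp add: field_simps)
        finally have z1: "norm z < 1" .
        have z0: "z \<noteq> 0" using False by (simp add: z_def)
        have zI: "z \<notin> \<int>"
          by (rule not_Ints_if_norm_less_1[OF z0 z1])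
        have eE: "eval_fps E t = of_real pi * z * cot (of_real pi * z) - 1"
          unfolding eval_fps_def using E_sums[of t z] t1 False by (simp add: sums_iff z_def)
        have c: "cot (of_real pi * z) = \<i> + 2 * \<i> / (exp t - 1)"
          using cot_pi_conv_exp(1)[OF zI] unfolding t2 .
        have e: "exp t - 1 \<noteq> 0"
          using cot_pi_conv_exp(2)[OF zI] unfolding t2 by simp
        have pz: "of_real pi * z = - \<i> * t / 2" by (simp add: z_def field_simps)
        have "eval_fps E t = (- \<i> * t / 2) * (\<i> + 2 * \<i> / (exp t - 1)) - 1"
          unfolding eE c unfolding pz ..
        hence "1 - t / 2 + eval_fps E t = t / (exp t - 1)"
          by (simp add: algebra_simps)
        thus ?thesis using e by simp
      qed simp
      finally show ?thesis by simp
    qed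
    moreover have "eventually (\<lambda>t::complex. t \<in> ball 0 1) (nhds 0)"
      by (intro eventually_nhds_in_open) auto
    ultimately show "eventually (\<lambda>t. eval_fps (A * (fps_exp 1 - 1)) t = eval_fps fps_X t) (nhds 0)"
      using eventually_mono by force
  qed simp
  moreover have "fps_exp 1 - 1 \<noteq> (0 :: complex fps)"
  proof
    assume "fps_exp 1 - 1 = (0 :: complex fps)"
    hence "fps_nth (fps_exp 1 - 1 :: complex fps) 1 = 0" by simp
    thus False by simp
  qed
  ultimately show ?thesis
    using bernoulli_fps_complex
      mult_right_cancel[of "fps_exp 1 - 1 :: complex fps" "Abs_fps (\<lambda>n. of_real (bernoulli n / fact n))" A]
    unfolding A_def by simp
qed

text \<open>Euler's formula, read off as the coefficient of index 2j; its alternating sign is hidden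
  in the even power of 2 pi i.\<close>

lemma bernoulli_even_complex:
  assumes "j \<ge> 1"
  shows "of_real (bernoulli (2 * j)) = - 2 * fact (2 * j) * of_real (zeta_nat (2 * j)) / (2 * of_real pi * \<i>) ^ (2 * j)"
proof -
  have "of_real (bernoulli (2 * j) / fact (2 * j)) =
      fps_nth (Abs_fps (\<lambda>n. of_real (bernoulli n / fact n) :: complex)) (2 * j)"
    by simp
  also have "\<dots> = - 2 * of_real (zeta_nat (2 * j)) / (2 * of_real pi * \<i>) ^ (2 * j)"
    unfolding bernoulli_expansion using assms by (simp add: fps_X_nth)
  finally have *: "of_real (bernoulli (2 * j) / fact (2 * j)) =
      - 2 * of_real (zeta_nat (2 * j)) / (2 * of_real pi * \<i>) ^ (2 * j)" .
  have "(of_real (bernoulli (2 * j)) :: complex) = of_real (bernoulli (2 * j) / fact (2 * j)) * fact (2 * j)"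
    by simp
  thus ?thesis unfolding * by simp
qed

lemma bernoulli_0: "bernoulli 0 = 1"
proof -
  have "fps_nth (Abs_fps (\<lambda>n. of_real (bernoulli n / fact n) :: complex)) 0 = 1"
    unfolding bernoulli_expansion by simp
  thus ?thesis by simp
qed

section \<open>Ramanujan's formula on the unit circle\<close>

text \<open>The terms \<open>j = 0\<close> and \<open>j = k\<close> are separated because \<open>zeta_nat 0\<close> is a junk value.\<close>

definition rotated_P :: "nat \<Rightarrow> complex \<Rightarrow> complex" where
  "rotated_P k w = of_real (2 / pi) * (\<Sum>j=1..<k. of_real (zeta_nat (2 * j) * zeta_nat (2 * k - 2 * j)) * w ^ (2 * j))
     - of_real (zeta_nat (2 * k) / pi) * (1 + w ^ (2 * k))
     + \<i> * of_real (zeta_nat (2 * k - 1)) * (w - w ^ (2 * k - 1))"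

section \<open>The polynomial after the rotation z = i w\<close>

text \<open>The factorials cancel against the binomial coefficient, and (2 pi i)^(2k) = (-1)^k (2
  pi)^(2k). Two factors -2 from Euler's formula leave the constant 4 / (2 pi).\<close>

lemma bernoulli_product_scaled:
  assumes "1 \<le> j" "j < k"
  shows "of_real ((2 * pi) ^ (2 * k - 1) / fact (2 * k)) *
      (of_real (bernoulli (2 * j)) * of_real (bernoulli (2 * k - 2 * j)) * of_nat ((2 * k) choose (2 * j)))
    = (-1) ^ k * of_real (2 / pi) * (of_real (zeta_nat (2 * j) * zeta_nat (2 * k - 2 * j)) :: complex)"
    (is "?lhs = _")
proof -
  define a where "a = 2 * of_real pi * \<i>"
  have a0: "a \<noteq> 0" by (simp add: a_def)
  have 1: "of_real (bernoulli (2 * j)) = - 2 * fact (2 * j) * of_real (zeta_nat (2 * j)) / a ^ (2 * j)"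
    using bernoulli_even_complex[of j] assms by (simp add: a_def)
  have 2: "of_real (bernoulli (2 * k - 2 * j)) = - 2 * fact (2 * k - 2 * j) * of_real (zeta_nat (2 * k - 2 * j)) / a ^ (2 * k - 2 * j)"
    using bernoulli_even_complex[of "k - j"] assms by (simp add: a_def right_diff_distrib')
  have 3: "(of_nat ((2 * k) choose (2 * j)) :: complex) = fact (2 * k) / (fact (2 * j) * fact (2 * k - 2 * j))"
    using assms by (subst binomial_fact) auto
  have 4: "a ^ (2 * j) * a ^ (2 * k - 2 * j) = (-1) ^ k * (2 * of_real pi) * (2 * of_real pi) ^ (2 * k - 1)"
  proof -
    have "a ^ (2 * j) * a ^ (2 * k - 2 * j) = a ^ (2 * k)"
      using assms by (simp flip: power_add)
    also have "\<dots> = \<i> ^ (2 * k) * (2 * of_real pi) ^ Suc (2 * k - 1)"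
      using assms by (simp add: a_def power_mult_distrib mult_ac)
    also have "\<i> ^ (2 * k) = (-1) ^ k" by (simp add: power_mult)
    finally show ?thesis by simp
  qed
  define A B F C where "A = a ^ (2 * j)" and "B = a ^ (2 * k - 2 * j)"
    and "F = (fact (2 * k) :: complex)" and "C = (2 * of_real pi :: complex) ^ (2 * k - 1)"
  have nz: "A \<noteq> 0" "B \<noteq> 0" "F \<noteq> 0" "C \<noteq> 0"
    using a0 by (simp_all add: A_def B_def F_def C_def)
  have "?lhs = C / F * ((- 2 * fact (2 * j) * of_real (zeta_nat (2 * j)) / A) *
      (- 2 * fact (2 * k - 2 * j) * of_real (zeta_nat (2 * k - 2 * j)) / B) *
      (F / (fact (2 * j) * fact (2 * k - 2 * j))))"
    by (simp add: 1 2 3 A_def B_def F_def C_def)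
  also have "\<dots> = 4 * C / (A * B) * of_real (zeta_nat (2 * j) * zeta_nat (2 * k - 2 * j))"
    using nz by simp
  also have "A * B = (-1) ^ k * (2 * of_real pi) * C"
    using 4 by (simp add: A_def B_def C_def)
  also have "4 * C / ((-1) ^ k * (2 * of_real pi) * C) = (-1) ^ k * of_real (2 / pi)"
    using nz by (cases "even k") (simp_all add: field_simps)
  finally show ?thesis .
qed

text \<open>For the end terms j = 0 and j = k: the other Bernoulli factor there is 1, so Euler's
  formula enters once and leaves -2 / (2 pi).\<close>

lemma bernoulli_even_scaled:
  assumes "1 \<le> k"
  shows "of_real ((2 * pi) ^ (2 * k - 1) / fact (2 * k)) * of_real (bernoulli (2 * k))
    = - ((-1) ^ k) * (of_real (zeta_nat (2 * k) / pi) :: complex)"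
proof -
  have 1: "of_real (bernoulli (2 * k)) = - 2 * fact (2 * k) * of_real (zeta_nat (2 * k)) / (2 * of_real pi * \<i>) ^ (2 * k)"
    using bernoulli_even_complex[of k] assms by simp
  have "(2 * of_real pi * \<i>) ^ (2 * k) = \<i> ^ (2 * k) * (2 * of_real pi) ^ Suc (2 * k - 1)"
    using assms by (simp add: power_mult_distrib mult_ac)
  also have "\<i> ^ (2 * k) = (-1) ^ k" by (simp add: power_mult)
  finally have 2: "(2 * of_real pi * \<i>) ^ (2 * k) = (-1) ^ k * (2 * of_real pi) * (2 * of_real pi) ^ (2 * k - 1)"
    by simp
  show ?thesis
    unfolding 1 2 by (cases "even k") (simp_all add: field_simps)
qed

text \<open>The powers (i w)^(2j) absorb the alternating sign of the sum, and i^(2k - 1) = -i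
  (-1)^k, so every term retains the same factor (-1)^k.\<close>

lemma poly_P_poly_rotate:
  assumes k: "k \<ge> 2"
  shows "poly (P_poly k) (\<i> * w) = (-1) ^ k * rotated_P k w"
proof -
  define c :: complex where "c = of_real ((2 * pi) ^ (2 * k - 1) / fact (2 * k))"
  define b :: "nat \<Rightarrow> complex" where "b = (\<lambda>j. of_real (bernoulli (2 * j)) * of_real (bernoulli (2 * k - 2 * j)) * of_nat ((2 * k) choose (2 * j)))"
  have sq: "(-1) ^ j * x * (\<i> * w) ^ (2 * j) = x * w ^ (2 * j)" for j and x :: complex
    by (cases "even j") (simp_all add: power_mult power_mult_distrib)
  define T where "T = (\<Sum>j=0..k. (-1) ^ j * of_real (bernoulli (2 * j)) * of_real (bernoulli (2 * k - 2 * j))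
                      * of_nat ((2 * k) choose (2 * j)) * (\<i> * w) ^ (2 * j))"
  have "T = (\<Sum>j=0..k. b j * w ^ (2 * j))"
    unfolding T_def by (intro sum.cong refl) (simp add: b_def mult.assoc flip: sq)
  moreover have "{0..k} = insert 0 (insert k {1..<k})" using k by auto
  moreover have "(\<Sum>j\<in>insert 0 (insert k {1..<k}). b j * w ^ (2 * j))
      = b 0 + b k * w ^ (2 * k) + (\<Sum>j=1..<k. b j * w ^ (2 * j))"
    using k by simp
  moreover have "b 0 = of_real (bernoulli (2 * k))" "b k = of_real (bernoulli (2 * k))"
    by (simp_all add: b_def bernoulli_0)
  ultimately have "T = of_real (bernoulli (2 * k)) * (1 + w ^ (2 * k)) + (\<Sum>j=1..<k. b j * w ^ (2 * j))"
    by (simp add: algebra_simps)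
  hence sum_eq: "c * T = c * of_real (bernoulli (2 * k)) * (1 + w ^ (2 * k)) + (\<Sum>j=1..<k. (c * b j) * w ^ (2 * j))"
    by (simp only: distrib_left sum_distrib_left mult.assoc)
  have ce: "c * of_real (bernoulli (2 * k)) = - ((-1) ^ k) * of_real (zeta_nat (2 * k) / pi)"
    unfolding c_def using k by (intro bernoulli_even_scaled) auto
  have "(\<Sum>j=1..<k. (c * b j) * w ^ (2 * j))
      = (\<Sum>j=1..<k. (-1) ^ k * of_real (2 / pi) * of_real (zeta_nat (2 * j) * zeta_nat (2 * k - 2 * j)) * w ^ (2 * j))"
    unfolding c_def b_def by (intro sum.cong refl arg_cong2[of _ _ _ _ "(*)"] bernoulli_product_scaled) auto
  hence cs: "(\<Sum>j=1..<k. (c * b j) * w ^ (2 * j))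
      = (-1) ^ k * (of_real (2 / pi) * (\<Sum>j=1..<k. of_real (zeta_nat (2 * j) * zeta_nat (2 * k - 2 * j)) * w ^ (2 * j)))"
    by (simp only: sum_distrib_left mult.assoc)
  have z: "zeta (of_nat (2 * k - 1)) = of_real (zeta_nat (2 * k - 1))"
    using k by (intro zeta_of_nat) auto
  have i2: "(\<i> * w) ^ (2 * k - 1) = - ((-1) ^ k) * \<i> * w ^ (2 * k - 1)"
  proof -
    have "\<i> * \<i> ^ (2 * k - 1) = \<i> ^ (2 * k)" using k by (simp flip: power_Suc)
    also have "\<dots> = (-1) ^ k" by (simp add: power_mult)
    finally have "\<i> ^ (2 * k - 1) = - \<i> * (-1) ^ k"
      by (metis complex_i_mult_minus mult_minus_left minus_minus)
    thus ?thesis by (simp add: power_mult_distrib)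
  qed
  have c': "(2 * of_real pi) ^ (2 * k - 1) / fact (2 * k) = c"
    by (simp add: c_def)
  show ?thesis
    unfolding poly_P_poly c' T_def [symmetric] sum_eq ce cs z i2 rotated_P_def
    by (simp add: algebra_simps)
qed

section \<open>The double series and the Lambert series\<close>

text \<open>Multiplication by \<open>cnj w\<close> preserves the norm and moves the term with a onto
  the real axis; the imaginary part then gives a bound uniform in a.\<close>

lemma norm_real_minus_mult_ge:
  fixes w :: complex and a b :: real
  assumes "norm w = 1"
  shows "norm (of_real b - w * of_real a) \<ge> \<bar>b\<bar> * \<bar>Im w\<bar>"
proof -
  have "w * cnj w = 1"
    using assms by (simp add: complex_norm_square [symmetric])
  hence "cnj w * (of_real b - w * of_real a) = of_real b * cnj w - of_real a"
    by (simp add: algebra_simps)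
  moreover have "norm (cnj w * (of_real b - w * of_real a)) = norm (of_real b - w * of_real a)"
    using assms by (simp add: norm_mult)
  ultimately have "norm (of_real b - w * of_real a) = norm (of_real b * cnj w - of_real a)"
    by simp
  thus ?thesis
    using abs_Im_le_cmod[of "of_real b * cnj w - of_real a"] by (simp add: abs_mult)
qed

text \<open>Both factors of the difference of squares are bounded uniformly in a. This uniformity
  allows a product majorant for the double series.\<close>

lemma norm_sq_minus_sq_ge:
  fixes w :: complex and a b :: nat
  assumes "norm w = 1"
  shows "norm ((of_nat b)\<^sup>2 - w\<^sup>2 * (of_nat a)\<^sup>2) \<ge> (real b)\<^sup>2 * (Im w)\<^sup>2"
proof -
  have "(of_nat b)\<^sup>2 - w\<^sup>2 * (of_nat a)\<^sup>2
      = (of_real b - w * of_real a) * (of_real b - w * of_real (- real a))"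
    by (simp add: algebra_simps power2_eq_square)
  hence "norm ((of_nat b)\<^sup>2 - w\<^sup>2 * (of_nat a)\<^sup>2) =
      norm (of_real b - w * of_real a) * norm (of_real b - w * of_real (- real a))"
    by (simp only: norm_mult)
  moreover have "(\<bar>real b\<bar> * \<bar>Im w\<bar>) * (\<bar>real b\<bar> * \<bar>Im w\<bar>) \<le> \<dots>"
    by (intro mult_mono norm_real_minus_mult_ge assms) auto
  moreover have "(\<bar>real b\<bar> * \<bar>Im w\<bar>) * (\<bar>real b\<bar> * \<bar>Im w\<bar>) = (real b)\<^sup>2 * (Im w)\<^sup>2"
    by (simp add: power2_eq_square algebra_simps flip: abs_mult)
  ultimately show ?thesis by simp
qed

lemma has_sum_diff:
  fixes f g :: "'a \<Rightarrow> 'b :: topological_ab_group_add"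
  assumes "(f has_sum a) A" "(g has_sum b) A"
  shows "((\<lambda>x. f x - g x) has_sum a - b) A"
  using has_sum_add[OF assms(1), of "\<lambda>x. - g x" "- b"] assms(2) by (simp add: has_sum_uminus)

lemma has_sum_sum:
  fixes f :: "'i \<Rightarrow> 'a \<Rightarrow> 'b :: topological_comm_monoid_add"
  assumes "finite I" "\<And>i. i \<in> I \<Longrightarrow> (f i has_sum s i) A"
  shows "((\<lambda>x. \<Sum>i\<in>I. f i x) has_sum (\<Sum>i\<in>I. s i)) A"
  using assms by (induction I rule: finite_induct) (auto intro!: has_sum_add)

lemma not_Ints_if_Im:
  fixes z :: complex
  assumes "Im z \<noteq> 0"
  shows "z \<notin> \<int>"
  using assms by (auto elim!: Ints_cases)

text \<open>The zeta convolution equals G + w^(2k) cnj G with G = zeta(2k) / 2 - (pi i w / 2)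
  zeta(2k - 1) - pi i w L. In \<open>rotated_P\<close> the remaining zeta terms cancel exactly, and
  only L and its conjugate survive.\<close>

lemma rotated_P_Lambert:
  fixes w :: complex
  assumes k: "k \<ge> 2" and w: "norm w = 1" and Im_w: "Im w \<noteq> 0"
  obtains L where
    "((\<lambda>m. 1 / (of_nat (Suc m) ^ (2 * k - 1) * (exp (2 * of_real pi * \<i> * (w * of_nat (Suc m))) - 1))) has_sum L) UNIV"
    "rotated_P k w = 4 * w ^ k * of_real (Im (cnj w ^ (k - 1) * L))"
proof -
  define Y :: "nat \<Rightarrow> nat \<Rightarrow> complex" where
    "Y = (\<lambda>m n. (of_nat (Suc n))\<^sup>2 - w\<^sup>2 * (of_nat (Suc m))\<^sup>2)"
  define g :: "nat \<times> nat \<Rightarrow> complex" where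
    "g = (\<lambda>(m, n). w\<^sup>2 / (of_nat (Suc m) ^ (2 * k - 2) * Y m n))"
  define h :: "nat \<times> nat \<Rightarrow> complex" where
    "h = (\<lambda>(m, n). w ^ (2 * k) / (of_nat (Suc n) ^ (2 * k - 2) * Y m n))"
  define f :: "nat \<times> nat \<Rightarrow> complex" where
    "f = (\<lambda>(m, n). \<Sum>j=1..<k. w ^ (2 * j) / (of_nat (Suc n) ^ (2 * j) * of_nat (Suc m) ^ (2 * k - 2 * j)))"
  define c :: "nat \<Rightarrow> complex" where
    "c = (\<lambda>m. w\<^sup>2 / of_nat (Suc m) ^ (2 * k - 2) *
        ((1 / (w * of_nat (Suc m)) - of_real pi * cot (of_real pi * (w * of_nat (Suc m)))) / (2 * (w * of_nat (Suc m)))))"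
  define e where "e = (\<lambda>m. exp (2 * of_real pi * \<i> * (w * of_nat (Suc m))))"
  have w0: "w \<noteq> 0" using w by auto
  have wc: "w * cnj w = 1"
    using w by (simp add: complex_norm_square [symmetric])
  have Y_ge: "norm (Y m n) \<ge> (real (Suc n))\<^sup>2 * (Im w)\<^sup>2" for m n
    unfolding Y_def by (intro norm_sq_minus_sq_ge w)
  have Y_pos: "(real (Suc n))\<^sup>2 * (Im w)\<^sup>2 > 0" for n
    using Im_w by (simp del: of_nat_Suc)
  have Y0: "Y m n \<noteq> 0" for m n
    using Y_ge[of n m] Y_pos[of n] by auto
  have N0: "(of_nat (Suc m) :: complex) \<noteq> 0" for m
    by (simp del: of_nat_Suc)
  have pw: "x ^ (2 * k) = x\<^sup>2 * x ^ (2 * k - 2)" "x ^ (2 * k - 1) = x * x ^ (2 * k - 2)" for x :: complex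
  proof -
    have "2 * k = 2 + (2 * k - 2)" "2 * k - 1 = Suc (2 * k - 2)" using k by auto
    thus "x ^ (2 * k) = x\<^sup>2 * x ^ (2 * k - 2)" "x ^ (2 * k - 1) = x * x ^ (2 * k - 2)"
      by (metis power_add, metis power_Suc)
  qed
  have nI: "w * of_nat (Suc m) \<notin> \<int>" for m
    using Im_w by (intro not_Ints_if_Im) (simp del: of_nat_Suc)

  \<comment> \<open>The lower bound in \<open>Y_ge\<close> is free of m, so it combines with the
    power of m + 1 into a product; k >= 2 makes the exponent 2k - 2 at least 2.\<close>
  have maj: "(\<lambda>(m, n). 1 / real (Suc m) ^ (2 * k - 2) * (1 / real (Suc n) ^ 2 * (1 / (Im w)\<^sup>2))) summable_on UNIV \<times> UNIV"
  proof (intro summable_on_mult_Times summable_on_cmult_left)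
    show "(\<lambda>m. 1 / real (Suc m) ^ (2 * k - 2)) summable_on UNIV"
      by (rule has_sum_imp_summable[OF zeta_nat_has_sum]) (use k in simp)
    show "(\<lambda>m. 1 / real (Suc m) ^ 2) summable_on UNIV"
      by (rule has_sum_imp_summable[OF zeta_nat_has_sum]) simp
  qed auto
  have "g summable_on UNIV \<times> UNIV"
  proof (rule Infinite_Sum.abs_summable_summable, rule Infinite_Sum.abs_summable_on_comparison_test'[OF maj])
    fix x :: "nat \<times> nat"
    obtain m n where x: "x = (m, n)" by force
    have "norm (g x) = 1 / real (Suc m) ^ (2 * k - 2) * (1 / norm (Y m n))"
      by (simp add: x g_def norm_divide norm_mult norm_power w del: of_nat_Suc)
    also have "\<dots> \<le> 1 / real (Suc m) ^ (2 * k - 2) * (1 / ((real (Suc n))\<^sup>2 * (Im w)\<^sup>2))"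
      using Y_ge[of n m] Y_pos[of n] Y0[of m n] by (intro mult_left_mono divide_left_mono mult_pos_pos) auto
    finally show "norm (g x) \<le> (case x of (m, n) \<Rightarrow> 1 / real (Suc m) ^ (2 * k - 2) * (1 / real (Suc n) ^ 2 * (1 / (Im w)\<^sup>2)))"
      by (simp add: x)
  qed
  then obtain G where G: "(g has_sum G) (UNIV \<times> UNIV)"
    by (auto simp: summable_on_def)
  \<comment> \<open>On the unit circle \<open>w \<mapsto> 1 / w\<close> is conjugation, so the two halves of the double series are
      exchanged by it, and only \<open>g\<close> has to be evaluated.\<close>
  have h_eq: "h (m, n) = - (w ^ (2 * k)) * cnj (g (n, m))" for m n
  proof -
    have "w\<^sup>2 * cnj (Y n m) = - Y m n"
    proof -
      have "w\<^sup>2 * (cnj w)\<^sup>2 = 1" using wc by (simp flip: power_mult_distrib)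
      thus ?thesis by (simp add: Y_def algebra_simps del: of_nat_Suc)
    qed
    hence *: "cnj (Y n m) = - Y m n * (cnj w)\<^sup>2"
      using wc by (metis (no_types, lifting) mult.assoc mult.commute mult_1 power_mult_distrib power_one)
    have "cnj (g (n, m)) = (cnj w)\<^sup>2 / (of_nat (Suc n) ^ (2 * k - 2) * cnj (Y n m))"
      by (simp add: g_def del: of_nat_Suc)
    also have "\<dots> = - (1 / (of_nat (Suc n) ^ (2 * k - 2) * Y m n))"
      unfolding * using w0 Y0[of m n] N0[of n] by (simp add: divide_simps del: of_nat_Suc)
    finally show ?thesis by (simp add: h_def)
  qed
  have "((\<lambda>x. cnj (g x)) has_sum cnj G) (UNIV \<times> UNIV)"
    using G by (subst has_sum_cnj_iff)
  hence "((\<lambda>(m, n). cnj (g (n, m))) has_sum cnj G) (UNIV \<times> UNIV)"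
    by (subst (asm) has_sum_swap) 
  hence "((\<lambda>x. - (w ^ (2 * k)) * (case x of (m, n) \<Rightarrow> cnj (g (n, m)))) has_sum - (w ^ (2 * k)) * cnj G) (UNIV \<times> UNIV)"
    by (rule has_sum_cmult_right)
  moreover have "(\<lambda>x. - (w ^ (2 * k)) * (case x of (m, n) \<Rightarrow> cnj (g (n, m)))) = h"
    by (auto simp: fun_eq_iff h_eq)
  ultimately have H: "(h has_sum - (w ^ (2 * k)) * cnj G) (UNIV \<times> UNIV)" by simp

  \<comment> \<open>The sum over j is geometric with ratio q = (w M / N)^2, where 1 - q = Y / N^2 is
    nonzero; its end terms q and q^k become g and h.\<close>
  have f_eq: "f x = g x - h x" for x
  proof -
    obtain m n where x: "x = (m, n)" by force
    define M N :: complex where "M = of_nat (Suc m)" and "N = of_nat (Suc n)"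
    have nz: "M \<noteq> 0" "N \<noteq> 0" using N0 by (simp_all add: M_def N_def del: of_nat_Suc)
    define q where "q = (w * M / N)\<^sup>2"
    have NY: "N\<^sup>2 - w\<^sup>2 * M\<^sup>2 = Y m n" by (simp add: Y_def M_def N_def)
    have q1: "1 - q = Y m n / N\<^sup>2"
      using nz by (simp add: q_def power_divide power_mult_distrib NY [symmetric] diff_divide_distrib)
    hence q_ne: "1 - q \<noteq> 0" using Y0[of m n] nz by simp
    have "f x = (\<Sum>j=1..<k. q ^ j / M ^ (2 * k))"
      unfolding x f_def prod.case M_def [symmetric] N_def [symmetric]
    proof (intro sum.cong refl)
      fix j assume j: "j \<in> {1..<k}"
      have "M ^ (2 * k) = M ^ (2 * j) * M ^ (2 * k - 2 * j)"
        using j by (simp flip: power_add)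
      thus "w ^ (2 * j) / (N ^ (2 * j) * M ^ (2 * k - 2 * j)) = q ^ j / M ^ (2 * k)"
        using nz by (simp add: q_def power_divide power_mult_distrib flip: power_mult)
    qed
    also have "\<dots> = (\<Sum>j=1..<k. q ^ j) / M ^ (2 * k)"
      by (simp add: sum_divide_distrib)
    also have "(\<Sum>j=1..<k. q ^ j) = (q - q ^ k) / (1 - q)"
    proof -
      have "(1 - q) * (\<Sum>j=1..<k. q ^ j) = q - q ^ k"
        using sum_Suc_diff'[of 1 k "\<lambda>j. - (q ^ j)"] k by (simp add: sum_distrib_left algebra_simps)
      thus ?thesis using q_ne by (simp add: field_simps)
    qed
    finally have "f x = q / ((1 - q) * M ^ (2 * k)) - q ^ k / ((1 - q) * M ^ (2 * k))"
      by (simp add: diff_divide_distrib)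
    also have "q / ((1 - q) * M ^ (2 * k)) = g x"
    proof -
      have gx: "g x = w\<^sup>2 / (M ^ (2 * k - 2) * Y m n)"
        by (simp only: x g_def prod.case M_def)
      have qe: "q = w\<^sup>2 * M\<^sup>2 / N\<^sup>2"
        by (simp add: q_def power_divide power_mult_distrib)
      show ?thesis
        unfolding q1 pw(1)[of M] gx unfolding qe using nz Y0[of m n] by simp
    qed
    also have "q ^ k / ((1 - q) * M ^ (2 * k)) = h x"
    proof -
      have hx: "h x = w ^ (2 * k) / (N ^ (2 * k - 2) * Y m n)"
        by (simp only: x h_def prod.case N_def)
      have qe: "q ^ k = w ^ (2 * k) * M ^ (2 * k) / N ^ (2 * k)"
        by (simp add: q_def power_divide power_mult_distrib flip: power_mult)
      show ?thesis
        unfolding q1 qe pw(1)[of N] hx using nz Y0[of m n] by simp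
    qed
    finally show ?thesis .
  qed
  have F: "(f has_sum G - (- (w ^ (2 * k)) * cnj G)) (UNIV \<times> UNIV)"
    using has_sum_diff[OF G H] by (simp add: f_eq [abs_def])

  define Z where "Z = (\<lambda>j. of_real (zeta_nat (2 * j)) :: complex)"
  define r where "r = (\<lambda>m. \<Sum>j=1..<k. w ^ (2 * j) * Z j * (1 / of_nat (Suc m) ^ (2 * k - 2 * j)))"
  have row: "((\<lambda>n. f (m, n)) has_sum r m) UNIV" for m
  proof -
    have "((\<lambda>n. \<Sum>j=1..<k. (w ^ (2 * j) * (1 / of_nat (Suc m) ^ (2 * k - 2 * j))) * (1 / of_nat (Suc n) ^ (2 * j)))
        has_sum (\<Sum>j=1..<k. (w ^ (2 * j) * (1 / of_nat (Suc m) ^ (2 * k - 2 * j))) * Z j)) UNIV"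
      unfolding Z_def by (intro has_sum_sum has_sum_cmult_right zeta_nat_has_sum_complex finite_atLeastLessThan) auto
    thus ?thesis by (simp add: f_def r_def mult_ac del: of_nat_Suc)
  qed
  \<comment> \<open>Second evaluation of the sum of f: first over n, then over m. The range 1 <= j <
    k keeps both exponents at least 2.\<close>
  have "(r has_sum (\<Sum>j=1..<k. w ^ (2 * j) * Z j * of_real (zeta_nat (2 * k - 2 * j)))) UNIV"
    unfolding r_def by (intro has_sum_sum has_sum_cmult_right zeta_nat_has_sum_complex finite_atLeastLessThan) auto
  moreover have "(r has_sum G - (- (w ^ (2 * k)) * cnj G)) UNIV"
    by (rule has_sum_SigmaD[OF F row])
  ultimately have "(\<Sum>j=1..<k. w ^ (2 * j) * Z j * of_real (zeta_nat (2 * k - 2 * j))) = G - (- (w ^ (2 * k)) * cnj G)"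
    by (rule has_sum_unique)
  hence sumG: "(\<Sum>j=1..<k. of_real (zeta_nat (2 * j) * zeta_nat (2 * k - 2 * j)) * w ^ (2 * j)) = G + w ^ (2 * k) * cnj G"
    by (simp add: Z_def mult_ac)

  have "(c has_sum G) UNIV"
  proof (rule has_sum_SigmaD[OF G])
    fix m
    \<comment> \<open>Partial fractions give only ordered convergence; unconditional summability of
      the row comes from the double series, and uniqueness identifies the value.\<close>
    have "((\<lambda>n. g (m, n)) summable_on UNIV)"
      using \<open>g summable_on UNIV \<times> UNIV\<close> summable_on_SigmaD1[of "\<lambda>m n. g (m, n)" UNIV "\<lambda>_. UNIV" m] by simp
    then obtain s where s: "((\<lambda>n. g (m, n)) has_sum s) UNIV"
      by (auto simp: summable_on_def)
    have "(\<lambda>n. w\<^sup>2 / of_nat (Suc m) ^ (2 * k - 2) * (1 / ((of_nat (Suc n))\<^sup>2 - (w * of_nat (Suc m))\<^sup>2))) sums c m"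
      unfolding c_def by (intro sums_mult cot_partial_fractions nI)
    hence "(\<lambda>n. g (m, n)) sums c m"
      by (simp add: g_def Y_def power_mult_distrib del: of_nat_Suc)
    with has_sum_imp_sums[OF s] have "s = c m" by (rule sums_unique2)
    with s show "((\<lambda>n. g (m, n)) has_sum c m) UNIV" by simp
  qed
  moreover have "c = (\<lambda>m. 1 / 2 * (1 / of_nat (Suc m) ^ (2 * k)) - of_real pi / 2 * \<i> * w * (1 / of_nat (Suc m) ^ (2 * k - 1))
      - of_real pi * \<i> * w * (1 / (of_nat (Suc m) ^ (2 * k - 1) * (e m - 1))))"
  proof
    fix m
    define M :: complex where "M = of_nat (Suc m)"
    have M0: "M \<noteq> 0" using N0 by (simp add: M_def del: of_nat_Suc)
    have cot: "cot (of_real pi * (w * M)) = \<i> + 2 * \<i> / (e m - 1)"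
      unfolding e_def M_def by (rule cot_pi_conv_exp[OF nI])
    define A E where "A = M ^ (2 * k - 2)" and "E = 1 / (e m - 1)"
    have A0: "A \<noteq> 0" using M0 by (simp add: A_def)
    have "c m = w\<^sup>2 / A * ((1 / (w * M) - of_real pi * (\<i> + 2 * \<i> * E)) / (2 * (w * M)))"
      unfolding c_def M_def [symmetric] A_def [symmetric] cot by (simp add: E_def)
    also have "\<dots> = 1 / 2 * (1 / (M\<^sup>2 * A)) - of_real pi / 2 * \<i> * w * (1 / (M * A)) - of_real pi * \<i> * w * (1 / (M * A) * E)"
      using w0 M0 A0 by (simp add: field_simps power2_eq_square)
    also have "1 / (M * A) * E = 1 / (M * A * (e m - 1))" by (simp add: E_def)
    finally show "c m = 1 / 2 * (1 / of_nat (Suc m) ^ (2 * k)) - of_real pi / 2 * \<i> * w * (1 / of_nat (Suc m) ^ (2 * k - 1))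
      - of_real pi * \<i> * w * (1 / (of_nat (Suc m) ^ (2 * k - 1) * (e m - 1)))"
      unfolding M_def [symmetric] pw A_def by simp
  qed
  ultimately have c_sum: "((\<lambda>m. 1 / 2 * (1 / of_nat (Suc m) ^ (2 * k)) - of_real pi / 2 * \<i> * w * (1 / of_nat (Suc m) ^ (2 * k - 1))
      - of_real pi * \<i> * w * (1 / (of_nat (Suc m) ^ (2 * k - 1) * (e m - 1)))) has_sum G) UNIV"
    by simp
  define z1 z2 :: complex where "z1 = of_real (zeta_nat (2 * k))" and "z2 = of_real (zeta_nat (2 * k - 1))"
  \<comment> \<open>The formula for G is solved for L; subtracting the series termwise then proves
    that the Lambert series converges to this value.\<close>
  define L where "L = (1 / 2 * z1 - of_real pi / 2 * \<i> * w * z2 - G) / (of_real pi * \<i> * w)"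
  have "((\<lambda>m. (1 / 2 * (1 / of_nat (Suc m) ^ (2 * k)) - of_real pi / 2 * \<i> * w * (1 / of_nat (Suc m) ^ (2 * k - 1))) -
      (1 / 2 * (1 / of_nat (Suc m) ^ (2 * k)) - of_real pi / 2 * \<i> * w * (1 / of_nat (Suc m) ^ (2 * k - 1))
      - of_real pi * \<i> * w * (1 / (of_nat (Suc m) ^ (2 * k - 1) * (e m - 1))))) has_sum
      (1 / 2 * z1 - of_real pi / 2 * \<i> * w * z2) - G) UNIV"
    unfolding z1_def z2_def
    by (intro has_sum_diff has_sum_cmult_right zeta_nat_has_sum_complex c_sum) (use k in auto)
  hence "((\<lambda>m. of_real pi * \<i> * w * (1 / (of_nat (Suc m) ^ (2 * k - 1) * (e m - 1)))) has_sum
      of_real pi * \<i> * w * L) UNIV"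
    using w0 by (simp add: L_def del: of_nat_Suc)
  hence "((\<lambda>m. (1 / (of_real pi * \<i> * w)) * (of_real pi * \<i> * w * (1 / (of_nat (Suc m) ^ (2 * k - 1) * (e m - 1))))) has_sum
      (1 / (of_real pi * \<i> * w)) * (of_real pi * \<i> * w * L)) UNIV"
    by (rule has_sum_cmult_right)
  hence L: "((\<lambda>m. 1 / (of_nat (Suc m) ^ (2 * k - 1) * (e m - 1))) has_sum L) UNIV"
    using w0 by (simp del: of_nat_Suc)

  have G_eq: "G = 1 / 2 * z1 - of_real pi / 2 * \<i> * w * z2 - of_real pi * \<i> * w * L"
    using w0 by (simp add: L_def)
  have cz: "cnj z1 = z1" "cnj z2 = z2" by (simp_all add: z1_def z2_def)
  have wk: "w ^ (2 * k) * cnj w = w ^ (2 * k - 1)"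
  proof -
    have "w ^ (2 * k) = w ^ (2 * k - 1) * w" using k by (simp flip: power_Suc2)
    thus ?thesis using wc by (simp add: mult.assoc)
  qed
  have "w ^ (2 * k) * cnj G = 1 / 2 * z1 * w ^ (2 * k) + of_real pi / 2 * \<i> * (w ^ (2 * k) * cnj w) * z2
      + of_real pi * \<i> * (w ^ (2 * k) * cnj w) * cnj L"
    unfolding G_eq by (simp add: cz algebra_simps)
  hence G2: "w ^ (2 * k) * cnj G = 1 / 2 * z1 * w ^ (2 * k) + of_real pi / 2 * \<i> * w ^ (2 * k - 1) * z2
      + of_real pi * \<i> * w ^ (2 * k - 1) * cnj L"
    unfolding wk .
  have "rotated_P k w = of_real (2 / pi) * (G + w ^ (2 * k) * cnj G) - z1 / of_real pi * (1 + w ^ (2 * k))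
      + \<i> * z2 * (w - w ^ (2 * k - 1))"
    unfolding rotated_P_def sumG by (simp add: z1_def z2_def)
  also have "\<dots> = - 2 * \<i> * (w * L - w ^ (2 * k - 1) * cnj L)"
    unfolding G2 unfolding G_eq by (simp add: field_simps)
  \<comment> \<open>As \<open>cnj w\<close> is 1 / w, extracting w^k leaves a number minus its
    conjugate.\<close>
  also have "w * L - w ^ (2 * k - 1) * cnj L = w ^ k * (cnj w ^ (k - 1) * L - cnj (cnj w ^ (k - 1) * L))"
  proof -
    have "w ^ k = w * w ^ (k - 1)" using k by (simp flip: power_Suc)
    moreover have "w ^ (k - 1) * cnj w ^ (k - 1) = 1" using wc by (simp flip: power_mult_distrib)
    ultimately have 1: "w ^ k * cnj w ^ (k - 1) = w" by simp
    have 2: "w ^ k * w ^ (k - 1) = w ^ (2 * k - 1)"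
    proof -
      have "k + (k - 1) = 2 * k - 1" using k by simp
      thus ?thesis by (metis power_add)
    qed
    show ?thesis
      using 1 2 by (simp add: right_diff_distrib flip: mult.assoc)
  qed
  also have "cnj w ^ (k - 1) * L - cnj (cnj w ^ (k - 1) * L) = 2 * \<i> * of_real (Im (cnj w ^ (k - 1) * L))"
    using complex_diff_cnj[of "cnj w ^ (k - 1) * L"] by (simp add: mult_ac)
  finally have "rotated_P k w = 4 * w ^ k * of_real (Im (cnj w ^ (k - 1) * L))"
    by (simp add: algebra_simps)
  with L show ?thesis unfolding e_def by (intro that)
qed

section \<open>Counting sign changes\<close>

text \<open>The phase \<open>\<psi>\<close> crosses N odd multiples of pi / 2. At these points g
  alternates in sign, so a zero lies strictly between consecutive ones; the N - 1 zeros are thus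
  strictly increasing, hence distinct.\<close>

lemma sign_change_zeros:
  fixes g \<psi> :: "real \<Rightarrow> real"
  assumes ab: "a \<le> b"
    and cont_\<psi>: "continuous_on {a..b} \<psi>" and mono: "strict_mono_on {a..b} \<psi>"
    and ends: "\<psi> a = 0" "\<psi> b = real N * pi"
    and cont_g: "continuous_on {a..b} g"
    and sign: "\<And>t j. a < t \<Longrightarrow> t < b \<Longrightarrow> \<psi> t = pi / 2 + real j * pi \<Longrightarrow> (-1) ^ j * g t > 0"
  obtains Z where "finite Z" "Z \<subseteq> {a<..<b}" "card Z = N - 1" "\<And>t. t \<in> Z \<Longrightarrow> g t = 0"
proof -
  have "\<exists>t. a < t \<and> t < b \<and> \<psi> t = pi / 2 + real j * pi" if j: "j < N" for j
  proof -
    have "(real j + 1 / 2) * pi < real N * pi"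
      using j by (intro mult_strict_right_mono) auto
    hence *: "pi / 2 + real j * pi < \<psi> b" by (simp add: ends algebra_simps)
    have **: "\<psi> a < pi / 2 + real j * pi" by (simp add: ends add_pos_nonneg)
    obtain t where "a \<le> t" "t \<le> b" "\<psi> t = pi / 2 + real j * pi"
      using IVT'[of \<psi> a "pi / 2 + real j * pi" b] * ** ab cont_\<psi> by auto
    moreover from this * ** have "t \<noteq> a" "t \<noteq> b" by auto
    ultimately show ?thesis by (intro exI[of _ t]) auto
  qed
  then obtain t where t: "\<And>j. j < N \<Longrightarrow> a < t j" "\<And>j. j < N \<Longrightarrow> t j < b"
    "\<And>j. j < N \<Longrightarrow> \<psi> (t j) = pi / 2 + real j * pi"
    by metis
  have t_less: "t i < t j" if "i < j" "j < N" for i j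
  proof (rule ccontr)
    assume "\<not> t i < t j"
    hence "\<psi> (t j) \<le> \<psi> (t i)"
      using that t(1,2)[of i] t(1,2)[of j] by (intro strict_mono_on_leD[OF mono]) auto
    moreover have "real i * pi < real j * pi" using that by simp
    ultimately show False using t(3)[of i] t(3)[of j] that by simp
  qed
  have "\<exists>r. t j < r \<and> r < t (Suc j) \<and> g r = 0" if j: "Suc j < N" for j
  proof -
    let ?f = "\<lambda>x. (-1) ^ j * g x"
    have 1: "?f (t j) > 0"
      using j by (intro sign t) auto
    have 2: "?f (t (Suc j)) < 0"
      using sign[OF t(1)[OF j] t(2)[OF j] t(3)[OF j]] by simp
    have "continuous_on {t j..t (Suc j)} ?f"
      using t(1)[of j] t(2)[of "Suc j"] j
      by (intro continuous_intros continuous_on_subset[OF cont_g]) auto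
    then obtain r where r: "t j \<le> r" "r \<le> t (Suc j)" "?f r = 0"
      using IVT2'[of ?f "t (Suc j)" 0 "t j"] 1 2 t_less[of j "Suc j"] j by auto
    moreover from this 1 2 have "r \<noteq> t j" "r \<noteq> t (Suc j)" by auto
    ultimately show ?thesis by (intro exI[of _ r]) auto
  qed
  then obtain r where r: "\<And>j. Suc j < N \<Longrightarrow> t j < r j" "\<And>j. Suc j < N \<Longrightarrow> r j < t (Suc j)"
    "\<And>j. Suc j < N \<Longrightarrow> g (r j) = 0"
    by metis
  have r_less: "r i < r j" if "i < j" "Suc j < N" for i j
  proof -
    have "r i < t (Suc i)" using that by (intro r) auto
    also have "t (Suc i) \<le> t j"
      using t_less[of "Suc i" j] that by (cases "Suc i = j") auto
    also have "t j < r j" using that by (intro r) auto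
    finally show ?thesis .
  qed
  have "inj_on r {..<N - 1}"
  proof (rule linorder_inj_onI')
    fix i j assume "i \<in> {..<N - 1}" "j \<in> {..<N - 1}" "i < j"
    hence "i < j" "Suc j < N" by auto
    thus "r i \<noteq> r j" using r_less[of i j] by auto
  qed
  hence "card (r ` {..<N - 1}) = N - 1" by (simp add: card_image)
  moreover have "r ` {..<N - 1} \<subseteq> {a<..<b}"
  proof clarify
    fix j assume "j < N - 1"
    hence "Suc j < N" by auto
    thus "r j \<in> {a<..<b}"
      using r(1,2)[of j] t(1)[of j] t(2)[of "Suc j"] by auto
  qed
  moreover have "g x = 0" if "x \<in> r ` {..<N - 1}" for x
    using that r(3) by auto
  ultimately show ?thesis
    by (intro that[of "r ` {..<N - 1}"]) auto
qed

section \<open>Real parts of the Lambert series\<close>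

text \<open>Meant for the powers of exp(2 pi i w) with w on the upper half circle, which lie in the
  open unit disc.\<close>

lemma Re_inverse_minus_1_neg:
  fixes v :: complex
  assumes "norm v < 1"
  shows "Re (1 / (v - 1)) < 0"
proof -
  have "Re v < 1" using complex_Re_le_cmod[of v] assms by linarith
  thus ?thesis
    by (simp add: Re_divide divide_simps sum_power2_gt_zero_iff)
qed

lemma one_minus_cos_le: "1 - cos x \<le> x\<^sup>2 / (2::real)"
proof -
  have "cos x = 1 - 2 * (sin (x / 2))\<^sup>2"
    using cos_double_sin[of "x / 2"] by simp
  moreover have "(sin (x / 2))\<^sup>2 \<le> (x / 2)\<^sup>2"
    using abs_sin_x_le_abs_x[of "x / 2"] by (simp only: abs_le_square_iff)
  ultimately show ?thesis by (simp add: power_divide)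
qed

text \<open>Both bounds serve to beat 1 / (4x): the first does so for x > 1/2. The second covers
  small x, where v may be close to 1 and growth of order 1 / x is required.\<close>

lemma Re_inverse_one_minus_exp:
  fixes x y :: real
  assumes x: "x > 0"
  defines "v \<equiv> of_real (exp (-x)) * cis (-y)"
  shows "Re (1 / (1 - v)) > 1 / 2"
    and "\<lbrakk>x \<le> 1 / 2; 1 - cos y \<le> x\<^sup>2 / 2\<rbrakk> \<Longrightarrow> Re (1 / (1 - v)) \<ge> 1 / (3 * x)"
proof -
  define \<rho> where "\<rho> = exp (-x)"
  have \<rho>: "0 < \<rho>" "\<rho> < 1" using x by (auto simp: \<rho>_def)
  define n where "n = 1 - \<rho> * cos y"
  define d where "d = 1 - 2 * \<rho> * cos y + \<rho>\<^sup>2"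
  have n: "n \<ge> 1 - \<rho>"
    using \<rho> mult_left_mono[of "cos y" 1 \<rho>] by (simp add: n_def)
  hence n0: "n > 0" using \<rho> by linarith
  have d_eq: "(1 - \<rho> * cos y)\<^sup>2 + (\<rho> * sin y)\<^sup>2 = d"
  proof -
    have "(1 - \<rho> * cos y)\<^sup>2 + (\<rho> * sin y)\<^sup>2 = 1 - 2 * \<rho> * cos y + \<rho>\<^sup>2 * ((sin y)\<^sup>2 + (cos y)\<^sup>2)"
      by (simp only: power2_eq_square) algebra
    thus ?thesis by (simp only: d_def sin_cos_squared_add mult_1_right)
  qed
  have d0: "d > 0"
    using n0 unfolding d_eq [symmetric] n_def by (intro add_pos_nonneg) auto
  have Re_eq: "Re (1 / (1 - v)) = n / d"
    unfolding Re_divide using d_eq by (simp add: v_def n_def flip: \<rho>_def)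
  have "\<rho>\<^sup>2 < 1" using \<rho> by (simp add: power_less_one_iff)
  hence "d < 2 * n" by (simp add: d_def n_def)
  thus "Re (1 / (1 - v)) > 1 / 2"
    unfolding Re_eq using d0 by (simp add: field_simps)
  assume x2: "x \<le> 1 / 2" and y: "1 - cos y \<le> x\<^sup>2 / 2"
  have "1 - \<rho> \<le> x" using exp_ge_add_one_self[of "-x"] by (simp add: \<rho>_def)
  hence "(1 - \<rho>)\<^sup>2 \<le> x\<^sup>2" using \<rho> by (intro power_mono) auto
  moreover have "2 * \<rho> * (1 - cos y) \<le> x\<^sup>2"
  proof -
    have "2 * \<rho> * (1 - cos y) \<le> 2 * (1 - cos y)"
      using \<rho> by (intro mult_right_mono) auto
    thus ?thesis using y by simp
  qed
  moreover have "d = (1 - \<rho>)\<^sup>2 + 2 * \<rho> * (1 - cos y)"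
    by (simp add: d_def power2_eq_square algebra_simps)
  ultimately have d2: "d \<le> 2 * x\<^sup>2" by simp
  have "\<rho> \<le> 1 / (1 + x)"
    using exp_ge_add_one_self[of x] x by (simp add: \<rho>_def exp_minus field_simps)
  hence \<rho>2: "x / (1 + x) \<le> 1 - \<rho>" using x by (simp add: field_simps)
  \<comment> \<open>The number 3/2 bounds 1 + x for x <= 1/2; together with d <= 2 x^2 it produces
    the 3 of the final bound.\<close>
  have "2 * x / 3 = x / (3 / 2)" by simp
  also have "\<dots> \<le> x / (1 + x)" using x x2 by (intro divide_left_mono) auto
  also note \<rho>2
  also note n
  finally have n2: "2 * x / 3 \<le> n" .
  have "1 / (3 * x) = (2 * x / 3) / (2 * x\<^sup>2)" using x by (simp add: power2_eq_square)
  also have "\<dots> \<le> n / d" using n2 d2 d0 n0 x by (intro frac_le) auto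
  finally show "Re (1 / (1 - v)) \<ge> 1 / (3 * x)" unfolding Re_eq .
qed

text \<open>The term \<open>m = 0\<close> is \<open>1 / 0 = 0\<close>.\<close>

lemma inverse_Suc_telescope_has_sum:
  "((\<lambda>m. 1 / (real m * real (Suc m))) has_sum 1) UNIV"
proof -
  have "(\<lambda>m. 1 / real (Suc m) - 1 / real (Suc (Suc m))) sums (1 / real (Suc 0) - 0)"
    by (intro telescope_sums' LIMSEQ_Suc lim_1_over_n)
  moreover have "1 / real (Suc m) - 1 / real (Suc (Suc m)) = 1 / (real (Suc m) * real (Suc (Suc m)))" for m
    by (simp add: field_simps)
  ultimately have "(\<lambda>m. 1 / (real (Suc m) * real (Suc (Suc m)))) sums 1" by simp
  hence "(\<lambda>m. 1 / (real m * real (Suc m))) sums (1 + 1 / (real 0 * real (Suc 0)))"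
    by (rule sums_Suc)
  thus ?thesis
    by (intro sums_nonneg_imp_has_sum) auto
qed

text \<open>Here U = exp(2 pi i w) with w = exp(-i t). The first term is 1 / (1 - 1/U), with real
  part above 1 / (4x), while the other terms together have norm at most 1 / (4x).\<close>

lemma Lambert_sum_lower_pos:
  fixes t :: real and p :: nat
  defines "x \<equiv> 2 * pi * sin t" and "y \<equiv> 2 * pi * cos t"
  defines "U \<equiv> of_real (exp x) * cis y"
  assumes t: "0 < t" "t < pi" and p: "p \<ge> 3"
    and X: "((\<lambda>m. U / (of_nat (Suc m) ^ p * (U ^ Suc m - 1))) has_sum X) UNIV"
  shows "Re X > 0"
proof -
  define f where "f = (\<lambda>m. U / (of_nat (Suc m) ^ p * (U ^ Suc m - 1)))"
  define v where "v = of_real (exp (-x)) * cis (-y)"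
  have st: "sin t > 0" using t by (intro sin_gt_zero) auto
  have x: "x > 0" using st by (simp add: x_def)
  have Uv: "U * v = 1"
  proof -
    have "U * v = of_real (exp x * exp (-x)) * (cis y * cis (-y))"
      by (simp add: U_def v_def mult_ac)
    thus ?thesis by (simp add: cis_mult exp_minus)
  qed
  have U0: "U \<noteq> 0" by (simp add: U_def)
  have nU: "norm U = exp x" by (simp add: U_def norm_mult)
  have "((\<lambda>m. if m = 0 then f 0 else 0) has_sum f 0) UNIV"
    by (rule has_sum_finite_neutralI[of "{0}"]) auto
  hence R: "((\<lambda>m. f m - (if m = 0 then f 0 else 0)) has_sum X - f 0) UNIV"
    using X by (intro has_sum_diff) (simp_all add: f_def)
  \<comment> \<open>A telescoping majorant. At m = 0 division by zero makes it 0, matching the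
    removed first term.\<close>
  have g: "((\<lambda>m. 1 / (4 * x) * (1 / (real m * real (Suc m)))) has_sum 1 / (4 * x) * 1) UNIV"
    by (intro has_sum_cmult_right inverse_Suc_telescope_has_sum)
  have "norm (X - f 0) \<le> 1 / (4 * x) * 1"
  proof (rule norm_infsum_le[OF R g])
    fix m :: nat
    show "norm (f m - (if m = 0 then f 0 else 0)) \<le> 1 / (4 * x) * (1 / (real m * real (Suc m)))"
    proof (cases "m = 0")
      case False
      define M where "M = real (Suc m)"
      have M: "M \<ge> 2" "real m = M - 1" using False by (auto simp: M_def)
      \<comment> \<open>After multiplication by e^x this bounds the denominator so that the
        numerator of norm e^x cancels.\<close>
      have "real m * x \<le> exp (real m * x) - 1"
        using exp_ge_add_one_self[of "real m * x"] by linarith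
      hence "exp x * (real m * x) \<le> exp x * (exp (real m * x) - 1)"
        by (rule mult_left_mono) simp
      also have "\<dots> = exp (M * x) - exp x"
        by (simp add: M_def algebra_simps flip: exp_add)
      also have "\<dots> \<le> exp (M * x) - 1" using x by simp
      also have "exp (M * x) = norm (U ^ Suc m)"
        unfolding norm_power nU M_def by (rule exp_of_nat_mult)
      also have "\<dots> - 1 \<le> norm (U ^ Suc m - 1)"
        using norm_triangle_ineq2[of "U ^ Suc m" 1] by simp
      finally have d: "exp x * (real m * x) \<le> norm (U ^ Suc m - 1)" .
      have pos: "exp x * (real m * x) > 0" using False x by simp
      \<comment> \<open>The 4 comes from M >= 2 and p >= 3; it has to exceed the 3 in the bound 1 /
        (3x) for the first term.\<close>
      have M4: "4 * M \<le> M ^ p"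
      proof -
        have "4 * M \<le> M\<^sup>2 * M"
          using M power_mono[of 2 M 2] by (intro mult_right_mono) auto
        also have "\<dots> = M ^ 3" by (simp add: power2_eq_square power3_eq_cube)
        also have "\<dots> \<le> M ^ p" using M p by (intro power_increasing) auto
        finally show ?thesis .
      qed
      have "norm (f m) = exp x / (M ^ p * norm (U ^ Suc m - 1))"
        by (simp add: f_def M_def norm_divide norm_mult norm_power nU del: of_nat_Suc power_Suc)
      also have "\<dots> \<le> exp x / ((4 * M) * (exp x * (real m * x)))"
        using d pos M M4 x False by (intro frac_le mult_mono mult_pos_pos) auto
      also have "\<dots> = 1 / (4 * x) * (1 / (real m * M))" by simp
      finally show ?thesis using False by (simp add: M_def)
    qed auto
  qed
  hence "\<bar>Re (X - f 0)\<bar> \<le> 1 / (4 * x)"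
    using abs_Re_le_cmod[of "X - f 0"] by simp
  moreover have "f 0 = 1 / (1 - v)"
  proof -
    have "U - 1 = U * (1 - v)" using Uv by (simp add: algebra_simps)
    thus ?thesis using U0 by (simp add: f_def)
  qed
  moreover have "Re (1 / (1 - v)) > 1 / (4 * x)"
  proof (cases "x \<le> 1 / 2")
    case False
    hence "1 / (4 * x) < 1 / 2" by (simp add: field_simps)
    thus ?thesis using Re_inverse_one_minus_exp(1)[OF x, of y] by (simp add: v_def)
  next
    case True
    \<comment> \<open>This is the distance from the absolute value of y to 2 pi. Near t = 0 and t =
      pi it vanishes quadratically but x only linearly; in general it is at most x.\<close>
    define \<delta> where "\<delta> = 2 * pi * (1 - \<bar>cos t\<bar>)"
    have c1: "\<bar>cos t\<bar> \<le> 1" by simp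
    have "1 * (1 - \<bar>cos t\<bar>) \<le> (1 + \<bar>cos t\<bar>) * (1 - \<bar>cos t\<bar>)"
      using c1 by (intro mult_right_mono) auto
    also have "\<dots> = (sin t)\<^sup>2" by (simp add: sin_squared_eq power2_eq_square algebra_simps)
    also have "\<dots> \<le> sin t * 1" unfolding power2_eq_square using st by (intro mult_left_mono) auto
    finally have "\<delta> \<le> x" by (simp add: \<delta>_def x_def)
    moreover have "\<delta> \<ge> 0" using c1 by (simp add: \<delta>_def)
    ultimately have "\<delta>\<^sup>2 \<le> x\<^sup>2" by (intro power_mono)
    moreover have "cos y = cos \<delta>"
    proof -
      have "cos \<delta> = cos (2 * pi - 2 * pi * \<bar>cos t\<bar>)" by (simp add: \<delta>_def algebra_simps)
      also have "\<dots> = cos (2 * pi * \<bar>cos t\<bar>)" by (simp add: cos_diff)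
      also have "\<dots> = cos \<bar>y\<bar>" by (simp add: y_def abs_mult)
      finally show ?thesis by simp
    qed
    ultimately have "1 - cos y \<le> x\<^sup>2 / 2" using one_minus_cos_le[of \<delta>] by simp
    hence "Re (1 / (1 - v)) \<ge> 1 / (3 * x)"
      using Re_inverse_one_minus_exp(2)[OF x True] by (simp add: v_def)
    moreover have "1 / (3 * x) > 1 / (4 * x)" using x by (simp add: field_simps)
    ultimately show ?thesis by linarith
  qed
  ultimately show ?thesis by simp
qed

section \<open>Sign pattern on the circle\<close>

text \<open>Off w = 1 and w = -1 the number inside \<open>Re\<close> is already real by Ramanujan's
  formula; \<open>Re\<close> turns it into a real function that is continuous everywhere.\<close>

definition circle_P :: "nat \<Rightarrow> real \<Rightarrow> real" where
  "circle_P k \<theta> = Re (cis (-\<theta>) ^ k * rotated_P k (cis \<theta>))"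

lemma continuous_on_circle_P: "continuous_on A (circle_P k)"
  unfolding circle_P_def [abs_def] rotated_P_def cis_conv_exp by (intro continuous_intros)

lemma cis_power_cancel: "cis (-\<theta>) ^ k * cis \<theta> ^ k = 1"
  by (simp add: cis_mult flip: power_mult_distrib)

text \<open>The last conclusion makes zeros of \<open>circle_P\<close> zeros of
  \<open>rotated_P\<close>; the first uses powers of one exponential, the form needed for the
  estimates.\<close>

lemma circle_P_Lambert:
  assumes k: "k \<ge> 2" and s: "sin \<theta> \<noteq> 0"
  obtains L where
    "((\<lambda>m. 1 / (of_nat (Suc m) ^ (2 * k - 1) * (exp (2 * of_real pi * \<i> * cis \<theta>) ^ Suc m - 1))) has_sum L) UNIV"
    "circle_P k \<theta> = 4 * Im (cis (-\<theta>) ^ (k - 1) * L)"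
    "rotated_P k (cis \<theta>) = cis \<theta> ^ k * of_real (circle_P k \<theta>)"
proof -
  obtain L where L:
    "((\<lambda>m. 1 / (of_nat (Suc m) ^ (2 * k - 1) * (exp (2 * of_real pi * \<i> * (cis \<theta> * of_nat (Suc m))) - 1))) has_sum L) UNIV"
    "rotated_P k (cis \<theta>) = 4 * cis \<theta> ^ k * of_real (Im (cnj (cis \<theta>) ^ (k - 1) * L))"
    using rotated_P_Lambert[of k "cis \<theta>"] k s by auto
  have e: "exp (2 * of_real pi * \<i> * (cis \<theta> * of_nat (Suc m))) = exp (2 * of_real pi * \<i> * cis \<theta>) ^ Suc m" for m
    by (subst exp_of_nat_mult [symmetric]) (simp only: mult_ac)
  define I where "I = Im (cis (-\<theta>) ^ (k - 1) * L)"
  have Q: "rotated_P k (cis \<theta>) = cis \<theta> ^ k * of_real (4 * I)"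
    using L(2) by (simp add: I_def cis_cnj)
  have "cis (-\<theta>) ^ k * rotated_P k (cis \<theta>) = of_real (4 * I)"
    unfolding Q by (simp add: cis_power_cancel flip: mult.assoc)
  hence F: "circle_P k \<theta> = 4 * I" by (simp add: circle_P_def)
  show ?thesis
    using L(1) Q F by (intro that[of L]) (simp_all only: e I_def)
qed

lemma cis_half_pi_plus: "cis (pi / 2 + real j * pi) = \<i> * (-1) ^ j"
proof -
  have "cis (pi / 2 + real j * pi) = cis (pi / 2) * cis pi ^ j"
    by (simp only: cis_mult Complex.DeMoivre)
  thus ?thesis by simp
qed

text \<open>At these angles cis(-theta)^(k - 1) equals -i (-1)^j, so the imaginary part reduces to
  Re L up to sign, and every term of L has negative real part.\<close>

lemma circle_P_sign_upper:
  assumes k: "k \<ge> 2" and \<theta>: "0 < \<theta>" "\<theta> < pi"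
    and j: "real (k - 1) * \<theta> = pi / 2 + real j * pi"
  shows "(-1) ^ j * circle_P k \<theta> > 0"
proof -
  have s: "sin \<theta> > 0" using \<theta> by (intro sin_gt_zero) auto
  define v where "v = exp (2 * of_real pi * \<i> * cis \<theta>)"
  obtain L where L: "((\<lambda>m. 1 / (of_nat (Suc m) ^ (2 * k - 1) * (v ^ Suc m - 1))) has_sum L) UNIV"
    "circle_P k \<theta> = 4 * Im (cis (-\<theta>) ^ (k - 1) * L)" "rotated_P k (cis \<theta>) = cis \<theta> ^ k * of_real (circle_P k \<theta>)"
    by (rule circle_P_Lambert[OF k less_imp_neq[OF s, symmetric], folded v_def])
  have v: "norm v < 1"
    using s by (simp add: v_def norm_exp_eq_Re)
  define T where "T = (\<lambda>m. - Re (1 / (of_nat (Suc m) ^ (2 * k - 1) * (v ^ Suc m - 1))))"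
  have T_pos: "T m > 0" for m
  proof -
    have "norm (v ^ Suc m) < 1"
      unfolding norm_power using v by (intro power_Suc_less_one) (auto simp: v_def)
    hence "Re (1 / (v ^ Suc m - 1)) < 0" by (rule Re_inverse_minus_1_neg)
    hence "1 / real (Suc m) ^ (2 * k - 1) * Re (1 / (v ^ Suc m - 1)) < 0"
      by (intro mult_pos_neg) simp_all
    moreover have eq: "1 / (of_nat (Suc m) ^ (2 * k - 1) * (v ^ Suc m - 1))
        = of_real (1 / real (Suc m) ^ (2 * k - 1)) * (1 / (v ^ Suc m - 1))"
      by (simp del: of_nat_Suc power_Suc)
    moreover have "Re (of_real r * z) = r * Re z" for r z by simp
    ultimately show ?thesis
      unfolding T_def eq by (simp only: neg_0_less_iff_less)
  qed
  \<comment> \<open>Comparison with the first term alone makes the inequality for Re L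
    strict.\<close>
  have "(T has_sum - Re L) UNIV"
    unfolding T_def by (intro has_sum_uminusI has_sum_Re L(1))
  moreover have "(T has_sum T 0) {0}" by (simp add: has_sum_finite_iff)
  ultimately have "T 0 \<le> - Re L"
    using has_sum_mono2[of T "{0}" "T 0" UNIV "- Re L"] T_pos less_imp_le by blast
  hence ReL: "Re L < 0" using T_pos[of 0] by linarith
  have "cis (-\<theta>) ^ (k - 1) = cnj (cis (real (k - 1) * \<theta>))"
    by (simp add: Complex.DeMoivre cis_cnj)
  also have "\<dots> = - \<i> * (-1) ^ j" unfolding j cis_half_pi_plus by simp
  finally have "circle_P k \<theta> = 4 * ((-1) ^ j * (- Re L))"
    unfolding L(2) by (cases "even j") simp_all
  thus ?thesis using ReL by (cases "even j") simp_all
qed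

text \<open>Positivity is known for Re (U L). Writing L as (U L) / U turns the phase by -2 pi cos t,
  the argument of 1/U; the added 2 pi makes the phase vanish at t = 0.\<close>

lemma circle_P_sign_lower:
  assumes k: "k \<ge> 2" and t: "0 < t" "t < pi"
    and j: "real (k - 1) * t + 2 * pi * (1 - cos t) = pi / 2 + real j * pi"
  shows "(-1) ^ j * circle_P k (-t) > 0"
proof -
  have s: "sin t > 0" using t by (intro sin_gt_zero) auto
  define x y where "x = 2 * pi * sin t" and "y = 2 * pi * cos t"
  define U where "U = of_real (exp x) * cis y"
  have "2 * of_real pi * \<i> * cis (-t) = Complex x y"
    by (simp add: complex_eq_iff x_def y_def)
  hence U_eq: "exp (2 * of_real pi * \<i> * cis (-t)) = U"
    by (simp add: U_def exp_eq_polar)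
  obtain L where L: "((\<lambda>m. 1 / (of_nat (Suc m) ^ (2 * k - 1) * (U ^ Suc m - 1))) has_sum L) UNIV"
    "circle_P k (-t) = 4 * Im (cis (-(-t)) ^ (k - 1) * L)" "rotated_P k (cis (-t)) = cis (-t) ^ k * of_real (circle_P k (-t))"
    by (rule circle_P_Lambert[OF k, of "-t", unfolded U_eq]) (use s in auto)
  have "((\<lambda>m. U * (1 / (of_nat (Suc m) ^ (2 * k - 1) * (U ^ Suc m - 1)))) has_sum U * L) UNIV"
    by (rule has_sum_cmult_right[OF L(1)])
  hence "((\<lambda>m. U / (of_nat (Suc m) ^ (2 * k - 1) * (U ^ Suc m - 1))) has_sum U * L) UNIV"
    by (simp only: times_divide_eq_right mult_1_right)
  hence ReX: "Re (U * L) > 0"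
    unfolding U_def x_def y_def using t k by (intro Lambert_sum_lower_pos[of t "2 * k - 1"]) auto
  have "cis t ^ (k - 1) = cis (real (k - 1) * t)" by (rule Complex.DeMoivre)
  also have "real (k - 1) * t = (pi / 2 + real j * pi) + (y - 2 * pi)"
    using j by (simp add: y_def algebra_simps)
  also have "cis \<dots> = \<i> * (-1) ^ j * cis y"
  proof -
    have "cis ((pi / 2 + real j * pi) + (y - 2 * pi)) = cis (pi / 2 + real j * pi) * (cis y / cis (2 * pi))"
      by (simp only: cis_mult cis_divide)
    thus ?thesis by (simp add: cis_half_pi_plus)
  qed
  also have "\<dots> = of_real (exp (-x)) * (\<i> * (-1) ^ j) * U"
    by (simp add: U_def exp_minus)
  finally have "cis (-(-t)) ^ (k - 1) * L = of_real (exp (-x)) * (\<i> * (-1) ^ j) * (U * L)"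
    by (simp add: mult_ac)
  moreover have "Im (of_real r * (\<i> * (-1) ^ j) * W) = r * ((-1) ^ j * Re W)" for r W
    by (cases "even j") simp_all
  ultimately have "circle_P k (-t) = 4 * (exp (-x) * ((-1) ^ j * Re (U * L)))"
    by (simp only: L(2))
  moreover have "(-1) ^ j * (4 * (e * ((-1) ^ j * R))) = 4 * e * R" for e R :: real
    by (cases "even j") simp_all
  ultimately have "(-1) ^ j * circle_P k (-t) = 4 * exp (-x) * Re (U * L)"
    by (simp only:)
  thus ?thesis using ReX by simp
qed

section \<open>Degree and multiplicities\<close>

lemma degree_P_poly_le:
  assumes "k \<ge> 1"
  shows "degree (P_poly k) \<le> 2 * k"
  unfolding P_poly_def
proof (intro degree_add_le order.trans[OF degree_smult_le])
  show "degree (\<Sum>j=0..k. monom ((-1) ^ j * of_real (bernoulli (2 * j)) * of_real (bernoulli (2 * k - 2 * j))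
                         * of_nat ((2 * k) choose (2 * j)) :: complex) (2 * j)) \<le> 2 * k"
  proof (rule degree_sum_le)
    fix j assume "j \<in> {0..k}"
    thus "degree (monom ((-1) ^ j * of_real (bernoulli (2 * j)) * of_real (bernoulli (2 * k - 2 * j))
                         * of_nat ((2 * k) choose (2 * j)) :: complex) (2 * j)) \<le> 2 * k"
      by (intro order.trans[OF degree_monom_le]) simp
  qed simp
  show "degree (monom 1 (2 * k - 1) :: complex poly) \<le> 2 * k"
    by (rule order.trans[OF degree_monom_le]) simp
  show "degree (monom ((-1) ^ k) 1 :: complex poly) \<le> 2 * k"
    by (rule order.trans[OF degree_monom_le]) (use assms in simp)
qed

text \<open>The value at 0 is zeta(2k) / pi up to sign.\<close>

lemma P_poly_nonzero:
  assumes "k \<ge> 2"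
  shows "P_poly k \<noteq> 0"
proof
  assume "P_poly k = 0"
  hence "(-1) ^ k * rotated_P k 0 = 0"
    using poly_P_poly_rotate[OF assms, of 0] by simp
  moreover have "rotated_P k 0 = - of_real (zeta_nat (2 * k) / pi)"
  proof -
    have "(\<Sum>j=1..<k. of_real (zeta_nat (2 * j) * zeta_nat (2 * k - 2 * j)) * (0 :: complex) ^ (2 * j)) = 0"
      by (intro sum.neutral) auto
    thus ?thesis using assms by (simp add: rotated_P_def power_0_left)
  qed
  ultimately show False using zeta_nat_gt_1[of "2 * k"] assms by simp
qed

text \<open>All orders are at least 1 and their sum is at most the degree, hence at most
  \<open>card S\<close>. This forces S to contain every root and every order to be 1.\<close>

lemma order_eq_1_if_enough_roots:
  fixes p :: "'a :: idom poly"
  assumes p: "p \<noteq> 0" and S: "finite S" "\<And>z. z \<in> S \<Longrightarrow> poly p z = 0" "card S \<ge> degree p"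
    and z: "poly p z = 0"
  shows "z \<in> S" "order z p = 1"
proof -
  define R where "R = {z. poly p z = 0}"
  have fin: "finite R" unfolding R_def using p by (rule poly_roots_finite)
  have ord: "order w p \<ge> 1" if "w \<in> R" for w
    using that p by (simp add: R_def order_root Suc_le_eq)
  have "(\<Sum>w\<in>R. order w p) \<le> degree p"
    unfolding R_def by (rule sum_order_le_degree[OF p])
  hence le: "(\<Sum>w\<in>R. order w p) \<le> card S" using S(3) by linarith
  have sub: "S \<subseteq> R" using S(2) by (auto simp: R_def)
  have "card R \<le> (\<Sum>w\<in>R. order w p)"
    using sum_mono[of R "\<lambda>_. 1" "\<lambda>w. order w p"] ord by simp
  hence RS: "S = R" using le sub fin by (intro card_seteq) auto
  have zR: "z \<in> R" using z by (simp add: R_def)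
  thus "z \<in> S" by (simp add: RS)
  have "(\<Sum>w\<in>R. order w p) = order z p + (\<Sum>w\<in>R - {z}. order w p)"
    using fin zR by (simp add: sum.remove)
  moreover have "(\<Sum>w\<in>R - {z}. order w p) \<ge> card (R - {z})"
    using sum_mono[of "R - {z}" "\<lambda>_. 1" "\<lambda>w. order w p"] ord by simp
  moreover have "card R = Suc (card (R - {z}))"
    by (rule card.remove[OF fin zR])
  ultimately show "order z p = 1" using le ord[OF zR] unfolding RS by linarith
qed

theorem theorem5:
  fixes k :: nat
  assumes "2 \<le> k" and "k < 1000"
  shows "\<forall>z. poly (P_poly k) z = 0 \<longrightarrow> norm z = 1 \<and> order z (P_poly k) = 1"
proof -
  note k = \<open>2 \<le> k\<close>
  \<comment> \<open>Upper half circle: the phase ends at (k - 1) pi. For k = 2 this set is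
    empty.\<close>
  obtain Z1 where Z1: "finite Z1" "Z1 \<subseteq> {0<..<pi}" "card Z1 = k - 1 - 1" "\<And>t. t \<in> Z1 \<Longrightarrow> circle_P k t = 0"
  proof (rule sign_change_zeros[of 0 pi "\<lambda>t. real (k - 1) * t" "k - 1" "circle_P k"])
    show "strict_mono_on {0..pi} (\<lambda>t. real (k - 1) * t)"
      using k by (auto simp: strict_mono_on_def)
  qed (use k in \<open>auto intro!: continuous_intros continuous_on_circle_P circle_P_sign_upper\<close>)
  \<comment> \<open>Lower half circle: 1 - cos t rises from 0 to 2, so the phase gains a further 4
    pi.\<close>
  obtain Z2 where Z2: "finite Z2" "Z2 \<subseteq> {0<..<pi}" "card Z2 = k + 3 - 1" "\<And>t. t \<in> Z2 \<Longrightarrow> circle_P k (-t) = 0"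
  proof (rule sign_change_zeros[of 0 pi "\<lambda>t. real (k - 1) * t + 2 * pi * (1 - cos t)" "k + 3" "\<lambda>t. circle_P k (-t)"])
    show "strict_mono_on {0..pi} (\<lambda>t. real (k - 1) * t + 2 * pi * (1 - cos t))"
    proof (rule strict_mono_onI)
      fix r s :: real assume "r \<in> {0..pi}" "s \<in> {0..pi}" "r < s"
      hence "real (k - 1) * r \<le> real (k - 1) * s" "cos s < cos r"
        by (auto intro!: mult_left_mono cos_monotone_0_pi)
      thus "real (k - 1) * r + 2 * pi * (1 - cos r) < real (k - 1) * s + 2 * pi * (1 - cos s)"
        by (intro add_le_less_mono mult_strict_left_mono) auto
    qed
    show "real (k - 1) * pi + 2 * pi * (1 - cos pi) = real (k + 3) * pi"
      using k by (simp add: of_nat_diff algebra_simps)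
    show "continuous_on {0..pi} (\<lambda>t. circle_P k (-t))"
      by (intro continuous_on_compose2[OF continuous_on_circle_P[of UNIV]] continuous_intros) auto
  qed (use k in \<open>auto intro!: continuous_intros circle_P_sign_lower\<close>)
  define Z where "Z = Z1 \<union> uminus ` Z2"
  have disj: "Z1 \<inter> uminus ` Z2 = {}"
  proof (intro equals0I, elim IntE imageE)
    fix a b assume "a \<in> Z1" "b \<in> Z2" "a = - b"
    moreover from this have "0 < a" "0 < b" using Z1(2) Z2(2) by auto
    ultimately show False by simp
  qed
  have "card Z = card Z1 + card (uminus ` Z2)"
    unfolding Z_def by (rule card_Un_disjoint) (use Z1(1) Z2(1) disj in simp_all)
  also have "card (uminus ` Z2) = card Z2" by (simp add: card_image)
  finally have card_Z: "card Z = 2 * k" using Z1(3) Z2(3) k by simp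
  have Z_range: "-pi < \<theta> \<and> \<theta> < pi \<and> sin \<theta> \<noteq> 0 \<and> circle_P k \<theta> = 0" if "\<theta> \<in> Z" for \<theta>
  proof -
    consider "\<theta> \<in> Z1" | t where "t \<in> Z2" "\<theta> = -t" using \<open>\<theta> \<in> Z\<close> by (auto simp: Z_def)
    thus ?thesis
    proof cases
      case 1
      hence "0 < \<theta>" "\<theta> < pi" using Z1(2) by auto
      thus ?thesis using sin_gt_zero[of \<theta>] Z1(4)[OF 1] by simp
    next
      case 2
      hence "0 < t" "t < pi" using Z2(2) by auto
      thus ?thesis using sin_gt_zero[of t] Z2(4)[OF 2(1)] 2(2) by simp
    qed
  qed
  define S where "S = (\<lambda>\<theta>. \<i> * cis \<theta>) ` Z"
  \<comment> \<open>All angles lie strictly between -pi and pi, so \<open>Arg\<close> recovers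
    them.\<close>
  have "inj_on (\<lambda>\<theta>. \<i> * cis \<theta>) Z"
  proof (rule inj_onI)
    fix a b assume ab: "a \<in> Z" "b \<in> Z" "\<i> * cis a = \<i> * cis b"
    have Arg: "Arg (cis \<theta>) = \<theta>" if "\<theta> \<in> Z" for \<theta>
    proof (rule cis_Arg_unique)
      show "sgn (cis \<theta>) = cis \<theta>" by (simp add: sgn_eq)
    qed (use Z_range[OF that] in linarith)+
    have "cis a = cis b"
      using ab(3) mult_left_cancel[OF complex_i_not_zero] by blast
    hence "Arg (cis a) = Arg (cis b)" by (rule arg_cong)
    thus "a = b" unfolding Arg[OF ab(1)] Arg[OF ab(2)] .
  qed
  hence card_S: "card S = 2 * k" by (simp add: S_def card_image card_Z)
  have fin_S: "finite S" using Z1(1) Z2(1) by (simp add: S_def Z_def)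
  have root_S: "poly (P_poly k) z = 0" if z: "z \<in> S" for z
  proof -
    obtain \<theta> where \<theta>: "\<theta> \<in> Z" "z = \<i> * cis \<theta>" using z by (auto simp: S_def)
    have "sin \<theta> \<noteq> 0" "circle_P k \<theta> = 0" using Z_range[OF \<theta>(1)] by auto
    hence "rotated_P k (cis \<theta>) = 0" by (elim circle_P_Lambert[OF k]) simp
    thus ?thesis using poly_P_poly_rotate[OF k] \<theta> by simp
  qed
  show ?thesis
  proof (intro allI impI)
    fix z assume z: "poly (P_poly k) z = 0"
    have deg: "degree (P_poly k) \<le> card S"
      using degree_P_poly_le[of k] k by (simp add: card_S)
    note * = order_eq_1_if_enough_roots[OF P_poly_nonzero[OF k] fin_S root_S deg z]
    from *(1) have "norm z = 1" by (auto simp: S_def norm_mult)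
    with *(2) show "norm z = 1 \<and> order z (P_poly k) = 1" by simp
  qed
qed

end
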